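(* Let $r\geq 3$, $k\geq 1$ and $\ell_1\geq\cdots\geq\ell_k\geq 2$ be integers, let $s\geq r$ be an integer, and let $n$ be sufficiently large. (i) If $s\leq k+r-2$, then $$\mathrm{ex}_r(n,K_s^{(r)},S^r_{\ell_1}\cup\cdots\cup S^r_{\ell_k})=\sum_{i=0}^{r-1}\binom{k-1}{s-i}\binom{n-k+1}{i}+\max_{\mathcal{G}\in\mathcal{F}_r(n-k+1,S^r_{\ell_k})}\sum_{i=r}^{s}\binom{k-1}{s-i}\mathcal{N}(K_i^{(r)},\mathcal{G}).$$ (ii) If $s\geq k+r-1$, then $\mathrm{ex}_r(n,K_s^{(r)},S^r_{\ell_1}\cup\cdots\cup S^r_{\ell_k})=O(n^{r-2})$. Moreover, if $k+r-1\leq s\leq\sum_{i=1}^k(\ell_i+1)+r-3$, then $\mathrm{ex}_r(n,K_s^{(r)},S^r_{\ell_1}\cup\cdots\cup S^r_{\ell_k})=\Theta(n^{r-2})$.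
   Context: An $r$-graph is a hypergraph all of whose hyperedges have exactly $r$ vertices. $K_i^{(r)}$ is the complete $r$-graph on $i$ vertices ($i\geq r$). $S_\ell$ is the star with $\ell$ edges. For a graph $F$, the $r$-expansion $F^r$ is obtained from $F$ by adding $r-2$ new vertices to each edge, all new vertices distinct from each other and from $V(F)$. $\cup$ denotes vertex-disjoint union. $\mathcal{N}(\mathcal{G}_1,\mathcal{G}_2)$ is the number of copies of $\mathcal{G}_1$ in $\mathcal{G}_2$. For an $r$-graph $\mathcal{H}$, $\mathcal{F}_r(m,\mathcal{H})$ is the family of all $m$-vertex $r$-graphs containing no copy of $\mathcal{H}$. $\mathrm{ex}_r(n,\mathcal{H},\mathcal{F})$ is the maximum number of copies of $\mathcal{H}$ in an $n$-vertex $r$-graph containing no copy of $\mathcal{F}$. Binomial coefficients: $\binom{a}{b}=0$ if $a<b$ (or $b<0$), and $\binom{0}{0}=1$. *)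

theory Defs
  imports Complex_Main "HOL-Library.Landau_Symbols"
begin

text \<open>A hypergraph is a pair of a vertex set and a set of hyperedges; graphs are the 2-uniform case.\<close>

type_synonym 'a hypergraph = "'a set \<times> 'a set set"

abbreviation verts :: "'a hypergraph \<Rightarrow> 'a set" where "verts \<equiv> fst"
abbreviation hedges :: "'a hypergraph \<Rightarrow> 'a set set" where "hedges \<equiv> snd"

definition r_graph :: "nat \<Rightarrow> 'a hypergraph \<Rightarrow> bool" where
  "r_graph r G \<longleftrightarrow> finite (verts G) \<and> (\<forall>e\<in>hedges G. e \<subseteq> verts G \<and> card e = r)"

definition complete_rgraph :: "nat \<Rightarrow> nat \<Rightarrow> nat hypergraph" where
  "complete_rgraph r i = ({..<i}, {e. e \<subseteq> {..<i} \<and> card e = r})"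

definition star :: "nat \<Rightarrow> nat hypergraph" where
  "star l = ({0..l}, (\<lambda>i. {0, i}) ` {1..l})"

text \<open>The new vertices added to an edge \<open>e\<close> are \<open>Inr (e, j)\<close> with \<open>j < r - 2\<close>.\<close>

definition expansion :: "nat \<Rightarrow> 'a hypergraph \<Rightarrow> ('a + 'a set \<times> nat) hypergraph" where
  "expansion r F =
     (Inl ` verts F \<union> Inr ` (hedges F \<times> {..<r - 2}),
      (\<lambda>e. Inl ` e \<union> Inr ` ({e} \<times> {..<r - 2})) ` hedges F)"

definition disjoint_union :: "'i set \<Rightarrow> ('i \<Rightarrow> 'a hypergraph) \<Rightarrow> ('i \<times> 'a) hypergraph" where
  "disjoint_union I G =
     (\<Union>i\<in>I. Pair i ` verts (G i), \<Union>i\<in>I. (\<lambda>e. Pair i ` e) ` hedges (G i))"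

definition star_expansion_union :: "nat \<Rightarrow> nat \<Rightarrow> (nat \<Rightarrow> nat) \<Rightarrow> (nat \<times> (nat + nat set \<times> nat)) hypergraph" where
  "star_expansion_union r k l = disjoint_union {1..k} (\<lambda>i. expansion r (star (l i)))"

definition subhypergraph :: "'a hypergraph \<Rightarrow> 'a hypergraph \<Rightarrow> bool" where
  "subhypergraph G' G \<longleftrightarrow>
     verts G' \<subseteq> verts G \<and> hedges G' \<subseteq> hedges G \<and> (\<forall>e\<in>hedges G'. e \<subseteq> verts G')"

definition hypergraph_iso :: "'a hypergraph \<Rightarrow> 'b hypergraph \<Rightarrow> bool" where
  "hypergraph_iso H G \<longleftrightarrow>
     (\<exists>f. bij_betw f (verts H) (verts G) \<and> hedges G = (\<lambda>e. f ` e) ` hedges H)"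

definition copies :: "'a hypergraph \<Rightarrow> 'b hypergraph \<Rightarrow> 'b hypergraph set" where
  "copies H G = {G'. subhypergraph G' G \<and> hypergraph_iso H G'}"

definition num_copies :: "'a hypergraph \<Rightarrow> 'b hypergraph \<Rightarrow> nat" where
  "num_copies H G = card (copies H G)"

text \<open>Every finite hypergraph has an isomorphic copy with vertices in \<^typ>\<open>nat\<close>, so
  it suffices to let the host hypergraphs range over finite vertex sets of naturals.\<close>

definition free_family :: "nat \<Rightarrow> nat \<Rightarrow> 'a hypergraph \<Rightarrow> nat hypergraph set" where
  "free_family r m H = {G. r_graph r G \<and> card (verts G) = m \<and> copies H G = {}}"

definition ex_count :: "nat \<Rightarrow> nat \<Rightarrow> 'a hypergraph \<Rightarrow> 'b hypergraph \<Rightarrow> nat" where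
  "ex_count r n H F = Max (num_copies H ` free_family r n F)"

text \<open>The maxima are genuine: the values are bounded, and \<^const>\<open>free_family\<close> is
  nonempty whenever the forbidden hypergraph has a hyperedge.\<close>

lemma num_copies_le:
  assumes "r_graph r G"
  shows "num_copies H G \<le> 2 ^ card (verts G) * 2 ^ (2 ^ card (verts G))"
proof -
  have fin: "finite (verts G)" and E: "hedges G \<subseteq> Pow (verts G)"
    using assms by (auto simp: r_graph_def)
  have "copies H G \<subseteq> Pow (verts G) \<times> Pow (Pow (verts G))"
    using E unfolding copies_def subhypergraph_def by fastforce
  then have "card (copies H G) \<le> card (Pow (verts G) \<times> Pow (Pow (verts G)))"
    using fin by (intro card_mono) auto
  then show ?thesis
    using fin by (simp add: num_copies_def card_cartesian_product card_Pow)
qed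

lemma finite_num_copies_image: "finite (num_copies H ` free_family r n F)"
  by (rule finite_subset[of _ "{..2 ^ n * 2 ^ (2 ^ n)}"])
     (auto simp: free_family_def dest: num_copies_le)

lemma finite_weighted_num_copies_image:
  "finite ((\<lambda>G. \<Sum>i=a..b. w i * num_copies (H i) G) ` free_family r n F)"
proof (rule finite_subset[of _ "{..\<Sum>i=a..b. w i * (2 ^ n * 2 ^ (2 ^ n))}"])
  show "(\<lambda>G. \<Sum>i=a..b. w i * num_copies (H i) G) ` free_family r n F
      \<subseteq> {..\<Sum>i=a..b. w i * (2 ^ n * 2 ^ (2 ^ n))}"
    by (auto simp: free_family_def intro!: sum_mono mult_le_mono2 dest: num_copies_le)
qed simp

lemma free_family_nonempty:
  assumes "hedges F \<noteq> {}"
  shows "free_family r n F \<noteq> {}"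
proof -
  have "({..<n}, {}) \<in> free_family r n F"
    using assms
    by (auto simp: free_family_def r_graph_def copies_def subhypergraph_def hypergraph_iso_def)
  then show ?thesis by blast
qed

end

theory Submission
  imports Defs
begin

text \<open>
  Call a vertex rich if a large constant number of hyperedges through it meet pairwise only there.
  Stars can be grown greedily at distinct rich vertices, so a host avoiding the union of expanded
  stars has at most \<open>k - 1\<close> of them. The link of a vertex \<open>v\<close> that is not rich has no large matching,
  hence is covered by a set \<open>T v\<close> of bounded size. In a clique \<open>Q\<close> with at least \<open>r\<close> vertices, none of
  them rich, each \<open>v\<close> then has at most \<open>r - 2\<close> vertices of \<open>Q - {v}\<close> outside \<open>T v\<close>, and this forces \<open>Q\<close>
  to lie within three applications of \<open>T\<close> from some \<open>r - 2\<close> of its vertices; so there are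
  \<open>O(n ^ (r - 2))\<close> such cliques. Sorting the copies of the complete \<open>r\<close>-graph by their trace on the
  rich set \<open>A\<close> gives the upper bounds: if \<open>A\<close> has \<open>k - 1\<close> elements, then removing it leaves no expanded
  star with \<open>l k\<close> edges and the count is exact; if it has fewer, the coefficient of \<open>n ^ (r - 1)\<close> is
  strictly smaller.

  The lower bound in (i) joins \<open>k - 1\<close> new vertices to an optimal star-free \<open>r\<close>-graph in all possible
  ways. For (ii), take all \<open>r\<close>-sets meeting a fixed set of \<open>(\<Sum>i=1..k. l i + 1) - 1\<close> vertices at least
  twice: an expanded star with \<open>l i\<close> edges uses at least \<open>l i + 1\<close> of these vertices.
\<close>

section \<open>Cliques\<close>

text \<open>For \<open>i < r\<close> the edge condition is vacuous and every \<open>i\<close>-subset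
  of \<open>V\<close> counts. This is the source of the plain binomial coefficients in the first sum
  of (i).\<close>

definition cliques :: "nat \<Rightarrow> nat \<Rightarrow> 'a set \<Rightarrow> 'a set set \<Rightarrow> 'a set set" where
  "cliques r i V E = {Q. Q \<subseteq> V \<and> card Q = i \<and> (\<forall>e. e \<subseteq> Q \<and> card e = r \<longrightarrow> e \<in> E)}"

lemma finite_cliques: "finite V \<Longrightarrow> finite (cliques r i V E)"
  unfolding cliques_def by (rule finite_subset[of _ "Pow V"]) auto

lemma bij_betw_image_subsets:
  assumes "bij_betw f A B"
  shows "(`) f ` {e. e \<subseteq> A \<and> card e = r} = {e. e \<subseteq> B \<and> card e = r}"
proof -
  have inj: "inj_on f A" and B: "B = f ` A"
    using assms by (auto simp: bij_betw_def)
  show ?thesis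
  proof (intro set_eqI iffI)
    fix e assume "e \<in> (`) f ` {e. e \<subseteq> A \<and> card e = r}"
    then show "e \<in> {e. e \<subseteq> B \<and> card e = r}"
      using inj B by (auto simp: card_image inj_on_subset)
  next
    fix e assume e: "e \<in> {e. e \<subseteq> B \<and> card e = r}"
    then obtain U where "U \<subseteq> A" "inj_on f U" "e = f ` U"
      using B by (auto simp: subset_image_inj)
    then show "e \<in> (`) f ` {e. e \<subseteq> A \<and> card e = r}"
      using e by (auto simp: card_image)
  qed
qed

text \<open>A copy is determined by its vertex set: a bijection carries the \<open>r\<close>-subsets
  of its domain onto all \<open>r\<close>-subsets of its range, so the edges of the copy are
  forced.\<close>

lemma num_copies_complete_rgraph:
  assumes "r_graph r G"
  shows "num_copies (complete_rgraph r i) G = card (cliques r i (verts G) (hedges G))"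
proof -
  let ?\<phi> = "\<lambda>Q. (Q, {e. e \<subseteq> Q \<and> card e = r})"
  have "copies (complete_rgraph r i) G = ?\<phi> ` cliques r i (verts G) (hedges G)"
  proof (intro set_eqI iffI)
    fix G' assume G': "G' \<in> copies (complete_rgraph r i) G"
    then obtain f where f: "bij_betw f {..<i} (verts G')"
      and h: "hedges G' = (`) f ` {e. e \<subseteq> {..<i} \<and> card e = r}"
      by (auto simp: copies_def hypergraph_iso_def complete_rgraph_def)
    have h': "hedges G' = {e. e \<subseteq> verts G' \<and> card e = r}"
      using h bij_betw_image_subsets[OF f] by simp
    have "card (verts G') = i"
      using bij_betw_same_card[OF f] by simp
    then have "verts G' \<in> cliques r i (verts G) (hedges G)"
      using G' h' by (auto simp: cliques_def copies_def subhypergraph_def)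
    then show "G' \<in> ?\<phi> ` cliques r i (verts G) (hedges G)"
      using h' by (intro image_eqI[where x = "verts G'"]) (auto simp: prod_eq_iff)
  next
    fix G' assume "G' \<in> ?\<phi> ` cliques r i (verts G) (hedges G)"
    then obtain Q where Q: "Q \<in> cliques r i (verts G) (hedges G)" and G': "G' = ?\<phi> Q"
      by blast
    have "finite Q"
      using Q assms by (auto simp: cliques_def r_graph_def intro: finite_subset)
    then obtain f where f: "bij_betw f {..<i} Q"
      using Q by (metis (mono_tags, lifting) cliques_def mem_Collect_eq lessThan_atLeast0
          ex_bij_betw_nat_finite)
    have "hypergraph_iso (complete_rgraph r i) G'"
      unfolding hypergraph_iso_def complete_rgraph_def G'
      using f bij_betw_image_subsets[OF f, of r] by (intro exI[of _ f]) simp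
    then show "G' \<in> copies (complete_rgraph r i) G"
      using Q by (auto simp: copies_def subhypergraph_def G' cliques_def)
  qed
  moreover have "inj_on ?\<phi> (cliques r i (verts G) (hedges G))"
    by (auto simp: inj_on_def)
  ultimately show ?thesis
    by (simp add: num_copies_def card_image)
qed

lemma card_cliques_less:
  assumes "finite V" "i < r"
  shows "card (cliques r i V E) = card V choose i"
proof -
  have "card e \<noteq> r" if "Q \<subseteq> V" "card Q = i" "e \<subseteq> Q" for e Q
    using that assms by (metis card_mono finite_subset not_less)
  then have "cliques r i V E = {Q. Q \<subseteq> V \<and> card Q = i}"
    by (auto simp: cliques_def)
  then show ?thesis
    using n_subsets[OF \<open>finite V\<close>] by simp
qed

section \<open>Embeddings of expanded stars\<close>

definition embeds :: "('a \<Rightarrow> 'b) \<Rightarrow> 'a hypergraph \<Rightarrow> 'b hypergraph \<Rightarrow> bool" where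
  "embeds f H G \<longleftrightarrow> inj_on f (verts H) \<and> f ` verts H \<subseteq> verts G \<and> (\<forall>e\<in>hedges H. f ` e \<in> hedges G)"

text \<open>The image of an embedding is a copy; the assumption supplies the condition in
  \<open>subhypergraph\<close> that the edges of the image lie in its vertex set.\<close>

lemma copies_nonempty_iff:
  assumes "\<forall>e\<in>hedges H. e \<subseteq> verts H"
  shows "copies H G \<noteq> {} \<longleftrightarrow> (\<exists>f. embeds f H G)"
proof
  assume "copies H G \<noteq> {}"
  then obtain G' f where "subhypergraph G' G" "bij_betw f (verts H) (verts G')"
      "hedges G' = (\<lambda>e. f ` e) ` hedges H"
    by (auto simp: copies_def hypergraph_iso_def)
  then have "embeds f H G"
    by (auto simp: embeds_def bij_betw_def subhypergraph_def)
  then show "\<exists>f. embeds f H G" by blast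
next
  assume "\<exists>f. embeds f H G"
  then obtain f where f: "embeds f H G" by blast
  have "(f ` verts H, (\<lambda>e. f ` e) ` hedges H) \<in> copies H G"
    using f assms unfolding copies_def subhypergraph_def hypergraph_iso_def embeds_def bij_betw_def
    by (auto intro!: exI[of _ f])
  then show "copies H G \<noteq> {}" by blast
qed

lemma embeds_disjoint_union_iff:
  "(\<exists>f. embeds f (disjoint_union I H) G) \<longleftrightarrow>
   (\<exists>f. (\<forall>i\<in>I. embeds (f i) (H i) G) \<and>
      (\<forall>i\<in>I. \<forall>j\<in>I. i \<noteq> j \<longrightarrow> f i ` verts (H i) \<inter> f j ` verts (H j) = {}))"
proof
  assume "\<exists>f. embeds f (disjoint_union I H) G"
  then obtain f where f: "embeds f (disjoint_union I H) G" ..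
  let ?f = "\<lambda>i x. f (i, x)"
  have inj: "\<lbrakk>i \<in> I; j \<in> I; x \<in> verts (H i); y \<in> verts (H j); f (i, x) = f (j, y)\<rbrakk> \<Longrightarrow> i = j \<and> x = y" for i j x y
    using f unfolding embeds_def disjoint_union_def inj_on_def by fastforce
  have "embeds (?f i) (H i) G" if "i \<in> I" for i
  proof -
    have "inj_on (?f i) (verts (H i))"
      using inj that by (auto simp: inj_on_def)
    moreover have "?f i ` verts (H i) \<subseteq> verts G"
      using f that by (auto simp: embeds_def disjoint_union_def)
    moreover have "?f i ` e \<in> hedges G" if "e \<in> hedges (H i)" for e
    proof -
      have "f ` Pair i ` e \<in> hedges G"
        using f that \<open>i \<in> I\<close> by (auto simp: embeds_def disjoint_union_def)
      then show ?thesis by (simp add: image_image)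
    qed
    ultimately show ?thesis by (simp add: embeds_def)
  qed
  moreover have "\<forall>i\<in>I. \<forall>j\<in>I. i \<noteq> j \<longrightarrow> ?f i ` verts (H i) \<inter> ?f j ` verts (H j) = {}"
    using inj by blast
  ultimately show "\<exists>f. (\<forall>i\<in>I. embeds (f i) (H i) G) \<and>
      (\<forall>i\<in>I. \<forall>j\<in>I. i \<noteq> j \<longrightarrow> f i ` verts (H i) \<inter> f j ` verts (H j) = {})"
    by (intro exI[of _ ?f]) auto
next
  assume "\<exists>f. (\<forall>i\<in>I. embeds (f i) (H i) G) \<and>
      (\<forall>i\<in>I. \<forall>j\<in>I. i \<noteq> j \<longrightarrow> f i ` verts (H i) \<inter> f j ` verts (H j) = {})"
  then obtain f where f: "\<forall>i\<in>I. embeds (f i) (H i) G"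
    and d: "\<forall>i\<in>I. \<forall>j\<in>I. i \<noteq> j \<longrightarrow> f i ` verts (H i) \<inter> f j ` verts (H j) = {}"
    by (elim exE conjE) (rule that)
  let ?g = "\<lambda>p. f (fst p) (snd p)"
  have "inj_on ?g (verts (disjoint_union I H))"
  proof (rule inj_onI)
    fix p q assume p: "p \<in> verts (disjoint_union I H)" and q: "q \<in> verts (disjoint_union I H)"
      and eq: "?g p = ?g q"
    obtain i x where 1: "p = (i, x)" "i \<in> I" "x \<in> verts (H i)"
      using p by (auto simp: disjoint_union_def)
    obtain j y where 2: "q = (j, y)" "j \<in> I" "y \<in> verts (H j)"
      using q by (auto simp: disjoint_union_def)
    have "i = j"
      using d 1 2 eq by fastforce
    then show "p = q"
      using f 1 2 eq by (auto simp: embeds_def inj_on_def)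
  qed
  moreover have "?g ` verts (disjoint_union I H) \<subseteq> verts G"
    using f by (fastforce simp: disjoint_union_def embeds_def)
  moreover have "\<forall>e\<in>hedges (disjoint_union I H). ?g ` e \<in> hedges G"
    using f by (auto simp: disjoint_union_def embeds_def image_image)
  ultimately show "\<exists>f. embeds f (disjoint_union I H) G"
    unfolding embeds_def by blast
qed

section \<open>Expanded stars as sunflowers with a one-vertex kernel\<close>

definition star_at :: "'a set set \<Rightarrow> 'a \<Rightarrow> nat \<Rightarrow> 'a set set \<Rightarrow> bool" where
  "star_at E c m A \<longleftrightarrow> A \<subseteq> E \<and> finite A \<and> card A = m \<and> (\<forall>e\<in>A. c \<in> e) \<and>
     (\<forall>e\<in>A. \<forall>e'\<in>A. e \<noteq> e' \<longrightarrow> e \<inter> e' = {c})"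

definition star_edge :: "nat \<Rightarrow> nat \<Rightarrow> (nat + nat set \<times> nat) set" where
  "star_edge r j = Inl ` {0, j} \<union> Inr ` ({{0, j}} \<times> {..<r - 2})"

lemma hedges_expansion_star: "hedges (expansion r (star m)) = star_edge r ` {1..m}"
  by (simp add: expansion_def star_def star_edge_def image_image)

lemma verts_expansion_star:
  "verts (expansion r (star m)) = Inl ` {0..m} \<union> Inr ` ((\<lambda>i. {0, i}) ` {1..m} \<times> {..<r - 2})"
  by (simp add: expansion_def star_def)

lemma star_edge_subset_verts: "j \<in> {1..m} \<Longrightarrow> star_edge r j \<subseteq> verts (expansion r (star m))"
  by (auto simp: verts_expansion_star star_edge_def)

lemma star_of_embedding:
  assumes "embeds f (expansion r (star m)) G"
  shows "\<exists>c A. star_at (hedges G) c m A \<and> \<Union>A \<subseteq> f ` verts (expansion r (star m))"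
proof -
  let ?V = "verts (expansion r (star m))"
  let ?A = "(\<lambda>j. f ` star_edge r j) ` {1..m}"
  have inj: "inj_on f ?V"
    using assms by (simp add: embeds_def)
  \<comment> \<open>New vertices are tagged with their edge \<open>{0, j}\<close>, so two different
    edges share only the centre, and an injection preserves intersections.\<close>
  have meet: "f ` star_edge r i \<inter> f ` star_edge r j = {f (Inl 0)}"
    if "i \<in> {1..m}" "j \<in> {1..m}" "i \<noteq> j" for i j
  proof -
    have "star_edge r i \<inter> star_edge r j = {Inl 0}"
      using that by (auto simp: star_edge_def doubleton_eq_iff)
    then show ?thesis
      using inj_on_image_Int[OF inj star_edge_subset_verts star_edge_subset_verts] that
      by (metis image_empty image_insert)
  qed
  have "inj_on (\<lambda>j. f ` star_edge r j) {1..m}"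
  proof (rule inj_onI)
    fix i j assume ij: "i \<in> {1..m}" "j \<in> {1..m}" "f ` star_edge r i = f ` star_edge r j"
    then have "star_edge r i = star_edge r j"
      using inj_on_image_eq_iff[OF inj] star_edge_subset_verts by metis
    moreover have "Inl i \<in> star_edge r i" by (simp add: star_edge_def)
    ultimately show "i = j"
      using ij by (auto simp: star_edge_def)
  qed
  then have "card ?A = m"
    by (simp add: card_image)
  moreover have "?A \<subseteq> hedges G"
    using assms by (auto simp: embeds_def hedges_expansion_star)
  moreover have "\<forall>e\<in>?A. f (Inl 0) \<in> e"
    by (auto simp: star_edge_def)
  moreover have "\<forall>e\<in>?A. \<forall>e'\<in>?A. e \<noteq> e' \<longrightarrow> e \<inter> e' = {f (Inl 0)}"
  proof (intro ballI impI)
    fix e e' assume "e \<in> ?A" "e' \<in> ?A" "e \<noteq> e'"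
    then obtain i j where ij: "i \<in> {1..m}" "j \<in> {1..m}" and e: "e = f ` star_edge r i" "e' = f ` star_edge r j"
      by blast
    then have "i \<noteq> j" using \<open>e \<noteq> e'\<close> by blast
    then show "e \<inter> e' = {f (Inl 0)}"
      unfolding e by (rule meet[OF ij])
  qed
  ultimately have "star_at (hedges G) (f (Inl 0)) m ?A"
    unfolding star_at_def by blast
  moreover have "\<Union>?A \<subseteq> f ` ?V"
    by (intro Union_least) (use star_edge_subset_verts in blast)
  ultimately show ?thesis by blast
qed

text \<open>Enumerate the edges of \<open>A\<close> by \<open>h\<close> and the \<open>r - 1\<close>
  non-central vertices of edge \<open>h j\<close> by \<open>g j\<close>. The edges meet only in
  \<open>c\<close>, so all values \<open>g j a\<close> are distinct and can be handed out to the
  leaf and the \<open>r - 2\<close> new vertices of the \<open>j\<close>-th star edge.\<close>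

lemma embedding_of_star:
  assumes "r \<ge> 2" "m \<ge> 1" "r_graph r G" "star_at (hedges G) c m A"
  shows "\<exists>f. embeds f (expansion r (star m)) G \<and> f ` verts (expansion r (star m)) \<subseteq> \<Union>A"
proof -
  have A: "A \<subseteq> hedges G" "finite A" "card A = m" "\<And>e. e \<in> A \<Longrightarrow> c \<in> e"
    "\<And>e e'. \<lbrakk>e \<in> A; e' \<in> A; e \<noteq> e'\<rbrakk> \<Longrightarrow> e \<inter> e' = {c}"
    using assms(4) by (auto simp: star_at_def)
  obtain h where h: "bij_betw h {1..m} A"
    using A(2,3) by (metis ex_bij_betw_nat_finite_1)
  have hA: "h j \<in> A" if "j \<in> {1..m}" for j
    using h that by (auto simp: bij_betw_def)
  have "\<exists>g. bij_betw g {0..<r - 1} (h j - {c})" if "j \<in> {1..m}" for j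
  proof -
    have "h j \<in> hedges G" "c \<in> h j"
      using A hA[OF that] by auto
    then have "card (h j) = r" "finite (h j)" "c \<in> h j"
      using assms(3) unfolding r_graph_def by (metis, metis finite_subset, metis)
    then have "card (h j - {c}) = r - 1" "finite (h j - {c})" by auto
    then show ?thesis using ex_bij_betw_nat_finite by metis
  qed
  then obtain g where g: "\<And>j. j \<in> {1..m} \<Longrightarrow> bij_betw (g j) {0..<r - 1} (h j - {c})"
    by metis
  have gin: "g j a \<in> h j - {c}" if "j \<in> {1..m}" "a < r - 1" for j a
    using g[OF that(1)] that(2) by (auto simp: bij_betw_def)
  have ginj: "i = j \<and> a = b"
    if "i \<in> {1..m}" "j \<in> {1..m}" "a < r - 1" "b < r - 1" "g i a = g j b" for i j a b
  proof -
    have "h i = h j"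
    proof (rule ccontr)
      assume "h i \<noteq> h j"
      then have "h i \<inter> h j = {c}" by (rule A(5)[OF hA[OF that(1)] hA[OF that(2)]])
      moreover have "g i a \<in> h i \<inter> h j" "g i a \<noteq> c"
        using gin[OF that(1,3)] gin[OF that(2,4)] that(5) by simp_all
      ultimately show False by blast
    qed
    then have "i = j"
      using inj_onD[OF bij_betw_imp_inj_on[OF h]] that(1,2) by blast
    then show ?thesis
      using inj_onD[OF bij_betw_imp_inj_on[OF g[OF that(1)]], of a b] that by simp
  qed
  \<comment> \<open>Slot \<open>0\<close> of \<open>g j\<close> goes to the leaf \<open>j\<close>,
    slot \<open>Suc a\<close> to the new vertex number \<open>a\<close>. The edge tag is
    \<open>{0, j}\<close>, so \<open>Max e\<close> recovers \<open>j\<close>.\<close>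
  define f where "f x = (case x of Inl j \<Rightarrow> if j = 0 then c else g j 0 | Inr (e, a) \<Rightarrow> g (Max e) (Suc a))" for x
  let ?V = "verts (expansion r (star m))"
  have f0: "f (Inl 0) = c" and fl: "j \<in> {1..m} \<Longrightarrow> f (Inl j) = g j 0"
    and fr: "f (Inr ({0, j}, a)) = g j (Suc a)" for j a
    by (auto simp: f_def)
  have r0: "0 < r - 1" using assms(1) by simp
  \<comment> \<open>\<open>v j b\<close> is the star vertex placed in slot \<open>b\<close> of edge
    \<open>j\<close>; writing every non-central vertex in this form reduces injectivity of
    \<open>f\<close> to that of the pairs in \<open>ginj\<close>.\<close>
  define v :: "nat \<Rightarrow> nat \<Rightarrow> nat + nat set \<times> nat"
    where "v j b = (if b = 0 then Inl j else Inr ({0, j}, b - 1))" for j b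
  have V: "x = Inl 0 \<or> (\<exists>j\<in>{1..m}. \<exists>b<r - 1. f x = g j b \<and> x = v j b)" if "x \<in> ?V" for x
    using that unfolding verts_expansion_star
  proof (elim UnE imageE SigmaE)
    fix j assume x: "x = Inl j" "j \<in> {0..m}"
    show ?thesis
    proof (cases "j = 0")
      case False
      then have "j \<in> {1..m}" using x by simp
      then show ?thesis
        using x fl r0 by (intro disjI2 bexI[of _ j] exI[of _ 0]) (auto simp: v_def)
    qed (simp add: x)
  next
    fix p e a j assume "x = Inr p" "p = (e, a)" "a \<in> {..<r - 2}" "e = {0, j}" "j \<in> {1..m}"
    then show ?thesis
      using fr by (intro disjI2 bexI[of _ j] exI[of _ "Suc a"]) (auto simp: v_def)
  qed
  have inj: "inj_on f ?V"
  proof (rule inj_onI)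
    fix x y assume x: "x \<in> ?V" and y: "y \<in> ?V" and eq: "f x = f y"
    \<comment> \<open>Both vertices central, exactly one central, or neither. The middle case, for
      either of the two, is impossible because \<open>g\<close> avoids \<open>c\<close>.\<close>
    consider "x = Inl 0" "y = Inl 0"
      | j b where "j \<in> {1..m}" "b < r - 1" "c = g j b"
      | i a j b where "i \<in> {1..m}" "a < r - 1" "j \<in> {1..m}" "b < r - 1" "g i a = g j b" "x = v i a" "y = v j b"
      using V[OF x] V[OF y] eq f0 by metis
    then show "x = y"
    proof cases
      case 2
      then show ?thesis using gin by blast
    next
      case 3
      then show ?thesis using ginj by blast
    qed simp
  qed
  have edge: "f ` star_edge r j = h j" if "j \<in> {1..m}" for j
  proof -
    have "star_edge r j = insert (Inl 0) (insert (Inl j) ((\<lambda>a. Inr ({0, j}, a)) ` {..<r - 2}))"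
      by (auto simp: star_edge_def)
    then have "f ` star_edge r j = insert c (insert (g j 0) ((\<lambda>a. g j (Suc a)) ` {..<r - 2}))"
      by (simp add: image_image f0 fl[OF that] fr)
    also have "insert (g j 0) ((\<lambda>a. g j (Suc a)) ` {..<r - 2}) = g j ` {0..<r - 1}"
    proof -
      have "{0..<r - 1} = insert 0 (Suc ` {..<r - 2})"
        using assms(1) lessThan_Suc_eq_insert_0[of "r - 2"]
        by (simp add: atLeast0LessThan Suc_diff_Suc numeral_2_eq_2)
      then show ?thesis by (simp add: image_image)
    qed
    also have "insert c (g j ` {0..<r - 1}) = h j"
      using g[OF that] A(4)[OF hA[OF that]] by (auto simp: bij_betw_def)
    finally show ?thesis .
  qed
  have sub: "f ` ?V \<subseteq> \<Union>A"
  proof -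
    have "?V \<subseteq> (\<Union>j\<in>{1..m}. star_edge r j)"
      using assms(2) by (fastforce simp: verts_expansion_star star_edge_def)
    then have "f ` ?V \<subseteq> (\<Union>j\<in>{1..m}. f ` star_edge r j)" by blast
    also have "\<dots> \<subseteq> \<Union>A" using edge hA by blast
    finally show ?thesis .
  qed
  have "\<Union>A \<subseteq> verts G"
    using A(1) assms(3) unfolding r_graph_def by blast
  moreover have "\<forall>e\<in>star_edge r ` {1..m}. f ` e \<in> hedges G"
  proof
    fix e assume "e \<in> star_edge r ` {1..m}"
    then obtain j where j: "j \<in> {1..m}" and e: "e = star_edge r j" by blast
    show "f ` e \<in> hedges G"
      unfolding e edge[OF j] using hA[OF j] A(1) by blast
  qed
  ultimately have "embeds f (expansion r (star m)) G"
    unfolding embeds_def hedges_expansion_star using inj sub by blast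
  then show ?thesis using sub by blast
qed

lemma copies_star_nonempty_iff:
  assumes "r \<ge> 2" "m \<ge> 1" "r_graph r G"
  shows "copies (expansion r (star m)) G \<noteq> {} \<longleftrightarrow> (\<exists>c A. star_at (hedges G) c m A)"
proof -
  have "\<forall>e\<in>hedges (expansion r (star m)). e \<subseteq> verts (expansion r (star m))"
    using star_edge_subset_verts by (fastforce simp: hedges_expansion_star)
  then show ?thesis
    using copies_nonempty_iff star_of_embedding embedding_of_star[OF assms] by metis
qed

text \<open>Since each \<open>l i\<close> is positive, the edges of every expanded star cover its
  vertices; hence the copies are vertex-disjoint exactly if the unions of their edges are.\<close>

lemma copies_star_union_nonempty_iff:
  assumes "r \<ge> 2" "\<And>i. i \<in> {1..k} \<Longrightarrow> l i \<ge> 1" "r_graph r G"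
  shows "copies (star_expansion_union r k l) G \<noteq> {} \<longleftrightarrow>
    (\<exists>c A. (\<forall>i\<in>{1..k}. star_at (hedges G) (c i) (l i) (A i)) \<and>
       (\<forall>i\<in>{1..k}. \<forall>j\<in>{1..k}. i \<noteq> j \<longrightarrow> \<Union>(A i) \<inter> \<Union>(A j) = {}))" (is "_ \<longleftrightarrow> ?R")
proof -
  let ?S = "\<lambda>i. expansion r (star (l i))"
  have "\<forall>e\<in>hedges (star_expansion_union r k l). e \<subseteq> verts (star_expansion_union r k l)"
    unfolding star_expansion_union_def disjoint_union_def fst_conv snd_conv hedges_expansion_star
    using star_edge_subset_verts by blast
  then have "copies (star_expansion_union r k l) G \<noteq> {} \<longleftrightarrow>
      (\<exists>f. (\<forall>i\<in>{1..k}. embeds (f i) (?S i) G) \<and>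
      (\<forall>i\<in>{1..k}. \<forall>j\<in>{1..k}. i \<noteq> j \<longrightarrow> f i ` verts (?S i) \<inter> f j ` verts (?S j) = {}))" (is "_ \<longleftrightarrow> ?L")
    unfolding embeds_disjoint_union_iff[symmetric] star_expansion_union_def[symmetric]
    by (rule copies_nonempty_iff)
  also have "?L \<longleftrightarrow> ?R"
  proof
    assume ?L
    then obtain f where f: "\<forall>i\<in>{1..k}. embeds (f i) (?S i) G"
      and d: "\<forall>i\<in>{1..k}. \<forall>j\<in>{1..k}. i \<noteq> j \<longrightarrow> f i ` verts (?S i) \<inter> f j ` verts (?S j) = {}"
      by (elim exE conjE) (rule that)
    have "\<forall>i\<in>{1..k}. \<exists>c A. star_at (hedges G) c (l i) A \<and> \<Union>A \<subseteq> f i ` verts (?S i)"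
      using f star_of_embedding by blast
    then obtain c A where "\<forall>i\<in>{1..k}. star_at (hedges G) (c i) (l i) (A i) \<and> \<Union>(A i) \<subseteq> f i ` verts (?S i)"
      by metis
    then have *: "\<And>i. i \<in> {1..k} \<Longrightarrow> star_at (hedges G) (c i) (l i) (A i)"
      and **: "\<And>i. i \<in> {1..k} \<Longrightarrow> \<Union>(A i) \<subseteq> f i ` verts (?S i)" by auto
    show ?R
    proof (intro exI[of _ c] exI[of _ A] conjI ballI impI *)
      fix i j assume "i \<in> {1..k}" "j \<in> {1..k}" "i \<noteq> j"
      then have "f i ` verts (?S i) \<inter> f j ` verts (?S j) = {}" using d by blast
      then show "\<Union>(A i) \<inter> \<Union>(A j) = {}"
        using **[OF \<open>i \<in> {1..k}\<close>] **[OF \<open>j \<in> {1..k}\<close>] by blast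
    qed
  next
    assume ?R
    then obtain c A where A: "\<forall>i\<in>{1..k}. star_at (hedges G) (c i) (l i) (A i)"
      and d: "\<forall>i\<in>{1..k}. \<forall>j\<in>{1..k}. i \<noteq> j \<longrightarrow> \<Union>(A i) \<inter> \<Union>(A j) = {}"
      by (elim exE conjE) (rule that)
    have "\<forall>i\<in>{1..k}. \<exists>f. embeds f (?S i) G \<and> f ` verts (?S i) \<subseteq> \<Union>(A i)"
      using A embedding_of_star[OF assms(1) assms(2) assms(3)] by blast
    then obtain f where "\<forall>i\<in>{1..k}. embeds (f i) (?S i) G \<and> f i ` verts (?S i) \<subseteq> \<Union>(A i)"
      by metis
    then have *: "\<And>i. i \<in> {1..k} \<Longrightarrow> embeds (f i) (?S i) G"
      and **: "\<And>i. i \<in> {1..k} \<Longrightarrow> f i ` verts (?S i) \<subseteq> \<Union>(A i)" by auto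
    show ?L
    proof (intro exI[of _ f] conjI ballI impI *)
      fix i j assume "i \<in> {1..k}" "j \<in> {1..k}" "i \<noteq> j"
      then have "\<Union>(A i) \<inter> \<Union>(A j) = {}" using d by blast
      then show "f i ` verts (?S i) \<inter> f j ` verts (?S j) = {}"
        using **[OF \<open>i \<in> {1..k}\<close>] **[OF \<open>j \<in> {1..k}\<close>] by blast
    qed
  qed
  finally show ?thesis .
qed

section \<open>Counting cliques\<close>

lemma star_at_subset: "star_at E c m A \<Longrightarrow> B \<subseteq> A \<Longrightarrow> star_at E c (card B) B"
  unfolding star_at_def by (meson finite_subset subset_iff)

lemma card_Union_star_le:
  assumes "\<forall>e\<in>E. finite e \<and> card e = r" "star_at E v m A"
  shows "finite (\<Union>A)" "card (\<Union>A) \<le> m * r"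
proof -
  have A: "A \<subseteq> E" "finite A" "card A = m" using assms(2) by (auto simp: star_at_def)
  show "finite (\<Union>A)" using A assms(1) by auto
  have "card (\<Union>A) \<le> (\<Sum>e\<in>A. card e)" by (rule card_Union_le_sum_card)
  also have "\<dots> = (\<Sum>e\<in>A. r)" by (rule sum.cong) (use A assms(1) in auto)
  finally show "card (\<Union>A) \<le> m * r" using A by simp
qed

text \<open>Take an inclusion-maximal star at \<open>v\<close>. It has fewer than \<open>M\<close>
  edges, and its vertices other than \<open>v\<close> meet every edge through \<open>v\<close>,
  since an edge missing them could be added to the star.\<close>

lemma link_cover:
  assumes "finite E" "\<forall>e\<in>E. finite e \<and> card e = r" "r \<ge> 2" and no_star: "\<nexists>A. star_at E v M A"
  shows "\<exists>T. finite T \<and> card T \<le> M * r \<and> v \<notin> T \<and> (\<forall>e\<in>E. v \<in> e \<longrightarrow> e \<inter> T \<noteq> {})"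
proof -
  let ?S = "{A. star_at E v (card A) A}"
  have "?S \<subseteq> Pow E" by (auto simp: star_at_def)
  then have "finite ?S" using assms(1) by (simp add: finite_subset)
  moreover have "{} \<in> ?S" by (simp add: star_at_def)
  ultimately obtain A where A: "star_at E v (card A) A"
    and max: "\<And>B. star_at E v (card B) B \<Longrightarrow> A \<subseteq> B \<Longrightarrow> A = B"
    using finite_has_maximal[of ?S] by blast
  have AE: "A \<subseteq> E" "finite A" and star: "\<And>e. e \<in> A \<Longrightarrow> v \<in> e"
      "\<And>e e'. e \<in> A \<Longrightarrow> e' \<in> A \<Longrightarrow> e \<noteq> e' \<Longrightarrow> e \<inter> e' = {v}"
    using A by (auto simp: star_at_def)
  have "card A < M"
  proof (rule ccontr)
    assume "\<not> card A < M"
    then obtain B where "B \<subseteq> A" "card B = M"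
      using obtain_subset_with_card_n[of M A] by auto
    then show False
      using star_at_subset[OF A] no_star by blast
  qed
  let ?T = "\<Union>A - {v}"
  have fin: "finite ?T" using AE assms(2) by auto
  have "card ?T \<le> card (\<Union>A)"
    by (rule card_mono) (use AE assms(2) in auto)
  also have "\<dots> \<le> card A * r"
    by (rule card_Union_star_le[OF assms(2) A])
  also have "\<dots> \<le> M * r" using \<open>card A < M\<close> by simp
  finally have card: "card ?T \<le> M * r" .
  have "e \<inter> ?T \<noteq> {}" if e: "e \<in> E" "v \<in> e" for e
  proof
    assume empty: "e \<inter> ?T = {}"
    have "star_at E v (card (insert e A)) (insert e A)"
      unfolding star_at_def
    proof (intro conjI ballI impI)
      fix a b assume "a \<in> insert e A" "b \<in> insert e A" "a \<noteq> b"
      then show "a \<inter> b = {v}"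
        using star empty e by blast
    qed (use AE e star in auto)
    \<comment> \<open>Maximality puts \<open>e\<close> itself into the star, so all its vertices
      except \<open>v\<close> lie in the cover; missing the cover then leaves \<open>e\<close> with
      at most one vertex.\<close>
    then have "e \<in> A" using max[of "insert e A"] by blast
    then have "e \<subseteq> {v}" using empty by blast
    then have "card e \<le> 1" using card_mono[of "{v}" e] by simp
    then show False using assms(2,3) e by auto
  qed
  then show ?thesis using fin card by blast
qed

text \<open>One closed out-neighbourhood step in the digraph with arcs from each \<open>v\<close> to
  the elements of \<open>T v\<close>.\<close>

definition reach :: "('a \<Rightarrow> 'a set) \<Rightarrow> 'a set \<Rightarrow> 'a set" where
  "reach T Z = Z \<union> \<Union>(T ` Z)"

lemma reach_mono: "Z \<subseteq> Z' \<Longrightarrow> reach T Z \<subseteq> reach T Z'"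
  by (auto simp: reach_def)

lemma reach_increasing: "Z \<subseteq> reach T Z"
  by (simp add: reach_def)

lemma card_reach_le:
  assumes "\<And>v. finite (T v) \<and> card (T v) \<le> t" "finite Z"
  shows "finite (reach T Z) \<and> card (reach T Z) \<le> (t + 1) * card Z"
proof
  show "finite (reach T Z)" using assms by (auto simp: reach_def)
  have "card (\<Union>(T ` Z)) \<le> (\<Sum>z\<in>Z. card (T z))" by (rule card_UN_le[OF assms(2)])
  also have "\<dots> \<le> (\<Sum>z\<in>Z. t)" by (rule sum_mono) (use assms in auto)
  finally show "card (reach T Z) \<le> (t + 1) * card Z"
    unfolding reach_def using card_Un_le[of Z "\<Union>(T ` Z)"] by (simp add: algebra_simps)
qed

text \<open>A vertex \<open>x\<close> together with the vertices it misses spans \<open>Q\<close> in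
  one step, but may have \<open>r - 1\<close> elements. The point is to save one: some element is
  reached from the others in two steps, either along an arc inside the set or through a vertex
  outside it.\<close>

lemma small_spanning_set:
  assumes "finite Q" "r \<ge> 3" "r \<le> card Q"
    and miss: "\<And>v. v \<in> Q \<Longrightarrow> card (Q - insert v (T v)) \<le> r - 2"
  shows "\<exists>Z\<subseteq>Q. card Z = r - 2 \<and> Q \<subseteq> reach T (reach T (reach T Z))"
proof -
  have "\<exists>Z\<subseteq>Q. card Z \<le> r - 2 \<and> Q \<subseteq> reach T (reach T (reach T Z))"
  proof -
    obtain x where x: "x \<in> Q" using assms by fastforce
    define Z0 where "Z0 = insert x (Q - insert x (T x))"
    have Z0: "Z0 \<subseteq> Q" "finite Z0" using x assms(1) by (auto simp: Z0_def)
    have card0: "card Z0 \<le> r - 1"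
      using miss[OF x] assms(1,2) by (simp add: Z0_def)
    have span: "Q \<subseteq> reach T Z0" by (auto simp: reach_def Z0_def)
    \<comment> \<open>Two steps from \<open>Z0 - {z}\<close> recover all of \<open>Z0\<close>, and
      the third step covers \<open>Q\<close>.\<close>
    have drop: ?thesis if "z \<in> Z0" "z \<in> reach T (reach T (Z0 - {z}))" for z
    proof -
      have "Z0 \<subseteq> reach T (reach T (Z0 - {z}))"
        using that reach_increasing[of "Z0 - {z}" T] reach_increasing[of "reach T (Z0 - {z})" T] by blast
      then have "Q \<subseteq> reach T (reach T (reach T (Z0 - {z})))"
        using span reach_mono by blast
      moreover have "card (Z0 - {z}) \<le> r - 2" using that card0 Z0 by simp
      ultimately show ?thesis using Z0 by blast
    qed
    have "card Z0 \<le> r - 2 \<or> card Z0 = r - 1" using card0 by linarith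
    then consider "card Z0 \<le> r - 2" | z z' where "z \<in> Z0" "z' \<in> Z0" "z \<noteq> z'" "z' \<in> T z"
      | "card Z0 = r - 1" "\<And>z z'. z \<in> Z0 \<Longrightarrow> z' \<in> Z0 \<Longrightarrow> z \<noteq> z' \<Longrightarrow> z' \<notin> T z"
      by blast
    then show ?thesis
    proof cases
      case 1
      have "Q \<subseteq> reach T (reach T (reach T Z0))"
        using span reach_increasing[of "reach T Z0" T] reach_increasing[of "reach T (reach T Z0)" T] by blast
      then show ?thesis using 1 Z0 by blast
    next
      case 2
      then have "z' \<in> reach T (reach T (Z0 - {z'}))"
        by (auto simp: reach_def)
      then show ?thesis using drop 2 by blast
    next
      case 3
      \<comment> \<open>Without arcs inside \<open>Z0\<close>, each \<open>z\<close> already misses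
        the other \<open>r - 2\<close> members, as many as allowed; so it has arcs to everything in
        \<open>Q\<close> outside \<open>Z0\<close>.\<close>
      have full: "Q - Z0 \<subseteq> T z" if z: "z \<in> Z0" for z
      proof -
        have "Z0 - {z} \<subseteq> Q - insert z (T z)" using 3(2) z Z0 by blast
        moreover have "card (Q - insert z (T z)) \<le> card (Z0 - {z})"
          using miss[of z] z Z0 3(1) by auto
        ultimately have "Z0 - {z} = Q - insert z (T z)"
          using assms(1) by (intro card_seteq) auto
        then show ?thesis using z by blast
      qed
      have "\<not> Q \<subseteq> Z0"
        using card_mono[OF Z0(2), of Q] 3(1) assms(2,3) by linarith
      then obtain w where w: "w \<in> Q" "w \<notin> Z0" by blast
      \<comment> \<open>\<open>w\<close> misses at most \<open>r - 2\<close> vertices while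
        \<open>Z0\<close> has \<open>r - 1\<close>, so some arc leads from \<open>w\<close> back
        into \<open>Z0\<close>.\<close>
      have "\<not> Z0 \<subseteq> Q - insert w (T w)"
        using card_mono[of "Q - insert w (T w)" Z0] miss[OF w(1)] 3(1) assms(1,2) by auto
      then obtain z where z: "z \<in> Z0" "z \<in> T w" using w Z0 by blast
      \<comment> \<open>Here \<open>r \<ge> 3\<close> enters: a second member \<open>z'\<close> of
        \<open>Z0\<close> exists, and \<open>z\<close> is reached from it by way of
        \<open>w\<close>.\<close>
      have "card (Z0 - {z}) \<noteq> 0" using z Z0 3(1) assms(2) by simp
      then have "Z0 - {z} \<noteq> {}" by (metis card.empty)
      then obtain z' where z': "z' \<in> Z0 - {z}" by blast
      then have "w \<in> reach T (Z0 - {z})" using full w by (auto simp: reach_def)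
      then have "z \<in> reach T (reach T (Z0 - {z}))" using z by (auto simp: reach_def)
      then show ?thesis using drop z by blast
    qed
  qed
  then obtain Z where Z: "Z \<subseteq> Q" "card Z \<le> r - 2" "Q \<subseteq> reach T (reach T (reach T Z))" by blast
  \<comment> \<open>Padding to exactly \<open>r - 2\<close> elements lets the spanning sets be
    counted by a single binomial coefficient.\<close>
  obtain Z' where Z': "Z \<subseteq> Z'" "Z' \<subseteq> Q" "card Z' = r - 2"
    using exists_subset_between[of Z "r - 2" Q] Z assms(1,3) by fastforce
  have "reach T (reach T (reach T Z)) \<subseteq> reach T (reach T (reach T Z'))"
    by (intro reach_mono Z')
  then show ?thesis using Z' Z by blast
qed

lemma binomial_le_power: "(n choose p) \<le> n ^ p"
  by (cases "p \<le> n") (auto simp: binomial_le_pow binomial_eq_0)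

text \<open>Every clique is a subset of the threefold \<open>reach\<close> of one of its
  \<open>(r - 2)\<close>-subsets, a set of at most \<open>(t + 1) ^ 3 * (r - 2)\<close> elements.
  The size bound on \<open>T v\<close> is asked for all \<open>v\<close> because
  \<open>reach\<close> may leave \<open>V\<close>.\<close>

lemma card_cliques_le:
  assumes "finite V" "r \<ge> 3" "r \<le> i"
    and T: "\<And>v. finite (T v) \<and> card (T v) \<le> t" "\<And>v. v \<in> V \<Longrightarrow> v \<notin> T v"
      "\<And>v e. v \<in> V \<Longrightarrow> e \<in> E \<Longrightarrow> v \<in> e \<Longrightarrow> e \<inter> T v \<noteq> {}"
  shows "card (cliques r i V E) \<le> 2 ^ ((t + 1) ^ 3 * (r - 2)) * card V ^ (r - 2)"
proof -
  let ?R = "\<lambda>Z. reach T (reach T (reach T Z))"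
  let ?Zs = "{Z. Z \<subseteq> V \<and> card Z = r - 2}"
  have finZ: "finite ?Zs" using assms(1) by (auto intro: finite_subset[of _ "Pow V"])
  have R: "finite (?R Z) \<and> card (?R Z) \<le> (t + 1) ^ 3 * (r - 2)" if Z: "Z \<in> ?Zs" for Z
  proof -
    have finZ: "finite Z" and cZ: "card Z = r - 2" using Z assms(1) by (auto intro: finite_subset)
    note 1 = card_reach_le[OF T(1) finZ]
    note 2 = card_reach_le[OF T(1) conjunct1[OF 1]]
    note 3 = card_reach_le[OF T(1) conjunct1[OF 2]]
    have "card (?R Z) \<le> (t + 1) * card (reach T (reach T Z))" using 3 by simp
    also have "\<dots> \<le> (t + 1) * ((t + 1) * card (reach T Z))" using 2 by (intro mult_le_mono2) simp
    also have "\<dots> \<le> (t + 1) * ((t + 1) * ((t + 1) * card Z))" using 1 by (intro mult_le_mono2) simp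
    also have "\<dots> = (t + 1) ^ 3 * (r - 2)" by (simp only: cZ power3_eq_cube mult.assoc)
    finally show ?thesis using 3 by simp
  qed
  have "cliques r i V E \<subseteq> (\<Union>Z\<in>?Zs. Pow (?R Z))"
  proof
    fix Q assume Q: "Q \<in> cliques r i V E"
    then have QV: "Q \<subseteq> V" "card Q = i" and QE: "\<And>e. e \<subseteq> Q \<Longrightarrow> card e = r \<Longrightarrow> e \<in> E"
      by (auto simp: cliques_def)
    have finQ: "finite Q" using QV assms(1) finite_subset by blast
    \<comment> \<open>Otherwise \<open>v\<close> and \<open>r - 1\<close> missed vertices form an
      \<open>r\<close>-subset of the clique, hence an edge through \<open>v\<close> disjoint from
      \<open>T v\<close>.\<close>
    have "card (Q - insert v (T v)) \<le> r - 2" if v: "v \<in> Q" for v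
    proof (rule ccontr)
      assume "\<not> card (Q - insert v (T v)) \<le> r - 2"
      then have "r - 1 \<le> card (Q - insert v (T v))" by simp
      then obtain D where D: "D \<subseteq> Q - insert v (T v)" "card D = r - 1" "finite D"
        by (rule obtain_subset_with_card_n)
      have "card (insert v D) = r"
        using D assms(2) by (subst card_insert_disjoint) auto
      then have "insert v D \<in> E" using QE[of "insert v D"] D v by blast
      then have "insert v D \<inter> T v \<noteq> {}" using T(3) v QV by blast
      then show False using T(2) D v QV by blast
    qed
    then obtain Z where "Z \<subseteq> Q" "card Z = r - 2" "Q \<subseteq> ?R Z"
      using small_spanning_set[OF finQ assms(2), of T] assms(3) QV(2) by blast
    then show "Q \<in> (\<Union>Z\<in>?Zs. Pow (?R Z))" using QV by blast
  qed
  then have "card (cliques r i V E) \<le> card (\<Union>Z\<in>?Zs. Pow (?R Z))"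
    by (rule card_mono[rotated]) (use finZ R in auto)
  also have "\<dots> \<le> (\<Sum>Z\<in>?Zs. card (Pow (?R Z)))"
    by (rule card_UN_le[OF finZ])
  also have "\<dots> \<le> (\<Sum>Z\<in>?Zs. 2 ^ ((t + 1) ^ 3 * (r - 2)))"
    by (rule sum_mono) (use R in \<open>auto simp: card_Pow intro!: power_increasing\<close>)
  also have "\<dots> = 2 ^ ((t + 1) ^ 3 * (r - 2)) * (card V choose (r - 2))"
    using n_subsets[OF assms(1), of "r - 2"] by simp
  also have "\<dots> \<le> 2 ^ ((t + 1) ^ 3 * (r - 2)) * card V ^ (r - 2)"
    by (intro mult_le_mono2 binomial_le_power)
  finally show ?thesis .
qed

text \<open>A clique \<open>Q\<close> is recovered from \<open>Q \<inter> A\<close> and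
  \<open>Q - A\<close>, and the latter is again a clique. If every \<open>r\<close>-set meeting
  \<open>A\<close> is an edge, any subset of \<open>A\<close> can be combined with any clique
  outside \<open>A\<close>, and the bound is attained.\<close>

lemma card_cliques_split:
  fixes E :: "'a set set" and r s :: nat
  assumes "finite V" "A \<subseteq> V"
  defines "N \<equiv> \<Sum>i=0..s. (card A choose (s - i)) * card (cliques r i (V - A) E)"
  shows card_cliques_split_le: "card (cliques r s V E) \<le> N"
    and card_cliques_split_eq:
      "(\<And>e. e \<subseteq> V \<Longrightarrow> card e = r \<Longrightarrow> e \<inter> A \<noteq> {} \<Longrightarrow> e \<in> E) \<Longrightarrow> card (cliques r s V E) = N"
proof -
  let ?\<phi> = "\<lambda>Q. (Q \<inter> A, Q - A)"
  let ?P = "\<lambda>i. {P. P \<subseteq> A \<and> card P = s - i}"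
  let ?U = "\<Union>i\<in>{0..s}. ?P i \<times> cliques r i (V - A) E"
  have finA: "finite A" using assms finite_subset by blast
  have finP: "finite (?P i)" for i using finA by (auto intro: finite_subset[of _ "Pow A"])
  have finC: "finite (cliques r i (V - A) E)" for i using assms(1) by (simp add: finite_cliques)
  have "card ?U = (\<Sum>i\<in>{0..s}. card (?P i \<times> cliques r i (V - A) E))"
    by (rule card_UN_disjoint) (use finP finC in \<open>auto simp: cliques_def\<close>)
  then have U: "card ?U = N"
    using n_subsets[OF finA] by (simp add: N_def card_cartesian_product)
  have inj: "inj_on ?\<phi> (cliques r s V E)"
    by (rule inj_onI) (metis Int_Diff_Un prod.inject)
  have sub: "?\<phi> ` cliques r s V E \<subseteq> ?U"
  proof (intro image_subsetI)
    fix Q assume Q: "Q \<in> cliques r s V E"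
    then have fQ: "finite Q" and cQ: "card Q = s" using assms(1) by (auto simp: cliques_def intro: finite_subset)
    have "card Q = card (Q \<inter> A) + card (Q - A)"
      using card_Un_disjoint[of "Q \<inter> A" "Q - A"] fQ by (simp add: Int_Diff_Un Int_Diff_disjoint)
    then have "card (Q - A) \<in> {0..s}" "Q \<inter> A \<in> ?P (card (Q - A))" using cQ by auto
    moreover have "Q - A \<in> cliques r (card (Q - A)) (V - A) E"
      using Q by (auto simp: cliques_def)
    ultimately show "?\<phi> Q \<in> ?U" by blast
  qed
  have finU: "finite ?U" using finP finC by auto
  show "card (cliques r s V E) \<le> N"
    using card_mono[OF finU sub] U card_image[OF inj] by simp
  assume full: "\<And>e. e \<subseteq> V \<Longrightarrow> card e = r \<Longrightarrow> e \<inter> A \<noteq> {} \<Longrightarrow> e \<in> E"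
  have "?U \<subseteq> ?\<phi> ` cliques r s V E"
  proof
    fix p assume "p \<in> ?U"
    then obtain i P R where p: "p = (P, R)" and i: "i \<le> s" and P: "P \<subseteq> A" "card P = s - i"
      and R: "R \<in> cliques r i (V - A) E" by auto
    have R': "R \<subseteq> V - A" "card R = i" "\<And>e. e \<subseteq> R \<Longrightarrow> card e = r \<Longrightarrow> e \<in> E"
      using R by (auto simp: cliques_def)
    have "finite P" "finite R" using P R' finA assms(1) by (auto intro: finite_subset)
    then have "card (P \<union> R) = s"
      using P R' i card_Un_disjoint[of P R] by fastforce
    moreover have "e \<in> E" if "e \<subseteq> P \<union> R" "card e = r" for e
    proof (cases "e \<inter> A = {}")
      case True
      then show ?thesis using R'(3)[of e] that P by blast
    next
      case False
      then show ?thesis using full[of e] that P R' assms(2) by blast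
    qed
    ultimately have "P \<union> R \<in> cliques r s V E"
      using P R' assms(2) by (auto simp: cliques_def)
    moreover have "p = ?\<phi> (P \<union> R)" using p P R' by blast
    ultimately show "p \<in> ?\<phi> ` cliques r s V E" by blast
  qed
  then have "?\<phi> ` cliques r s V E = ?U" using sub by blast
  then show "card (cliques r s V E) = N"
    using U card_image[OF inj] by simp
qed

section \<open>Disjoint stars\<close>

text \<open>The edges of a star are disjoint away from the centre, so each vertex of
  \<open>W\<close> spoils at most one of them, and at least \<open>m\<close> remain.\<close>

lemma star_avoiding:
  assumes "star_at E v M A" "finite W" "v \<notin> W" "card W + m \<le> M"
  shows "\<exists>B. star_at E v m B \<and> \<Union>B \<inter> W = {}"
proof -
  let ?H = "{e \<in> A. e \<inter> W \<noteq> {}}"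
  have A: "finite A" "card A = M" "\<And>e e'. e \<in> A \<Longrightarrow> e' \<in> A \<Longrightarrow> e \<noteq> e' \<Longrightarrow> e \<inter> e' = {v}"
    using assms(1) by (auto simp: star_at_def)
  define w where "w e = (SOME u. u \<in> e \<inter> W)" for e
  have w: "w e \<in> e \<inter> W" if "e \<in> ?H" for e
    unfolding w_def by (rule someI_ex) (use that in blast)
  have "inj_on w ?H"
  proof (rule inj_onI, rule ccontr)
    fix e e' assume e: "e \<in> ?H" "e' \<in> ?H" "w e = w e'" "e \<noteq> e'"
    then have "w e \<in> e \<inter> e'" using w[of e] w[of e'] by auto
    then have "w e = v" using A(3)[of e e'] e by auto
    then show False using w[of e] e assms(3) by auto
  qed
  moreover have "w ` ?H \<subseteq> W" using w by blast
  ultimately have "card ?H \<le> card W" using assms(2) by (rule card_inj_on_le)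
  moreover have "card (A - ?H) = card A - card ?H"
    by (rule card_Diff_subset) (use A(1) in auto)
  ultimately have "m \<le> card (A - ?H)"
    using A(2) assms(4) by linarith
  then obtain B where B: "B \<subseteq> A - ?H" "card B = m" by (rule obtain_subset_with_card_n)
  have "star_at E v m B" using star_at_subset[OF assms(1), of B] B by auto
  moreover have "\<Union>B \<inter> W = {}" using B by blast
  ultimately show ?thesis by blast
qed

text \<open>Greedy choice. The forbidden set \<open>W\<close> is generalised in the induction so
  that stars chosen early avoid centres treated later. The budget charges one unit for each such
  centre and \<open>l i * r\<close> for the vertices of the \<open>i\<close>-th star.\<close>

lemma disjoint_stars:
  assumes "finite I" "\<forall>e\<in>E. finite e \<and> card e = r"
    and "inj_on x I" "\<And>i. i \<in> I \<Longrightarrow> \<exists>A. star_at E (x i) M A"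
    and "finite W" "x ` I \<inter> W = {}" "card W + card I + (\<Sum>i\<in>I. l i * r) \<le> M"
  shows "\<exists>B. (\<forall>i\<in>I. star_at E (x i) (l i) (B i) \<and> \<Union>(B i) \<inter> W = {}) \<and>
    (\<forall>i\<in>I. \<forall>j\<in>I. i \<noteq> j \<longrightarrow> \<Union>(B i) \<inter> \<Union>(B j) = {})"
  using assms(1,3-)
proof (induction I arbitrary: W rule: finite_induct)
  case empty
  then show ?case by simp
next
  case (insert a I)
  \<comment> \<open>Forbidding \<open>x a\<close> as well raises \<open>card W\<close> by at most
    one, which is paid for by \<open>a\<close> no longer being counted in the index set.\<close>
  have "\<exists>B. (\<forall>i\<in>I. star_at E (x i) (l i) (B i) \<and> \<Union>(B i) \<inter> insert (x a) W = {}) \<and>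
    (\<forall>i\<in>I. \<forall>j\<in>I. i \<noteq> j \<longrightarrow> \<Union>(B i) \<inter> \<Union>(B j) = {})"
  proof (rule insert.IH)
    show "inj_on x I" using insert.prems(1) by simp
    show "\<And>i. i \<in> I \<Longrightarrow> \<exists>A. star_at E (x i) M A" using insert.prems(2) by blast
    show "finite (insert (x a) W)" using insert.prems by simp
    show "x ` I \<inter> insert (x a) W = {}" using insert.prems(1,4) insert.hyps by auto
    have "card (insert (x a) W) \<le> card W + 1"
      using insert.prems(3) by (simp add: card_insert_if)
    then show "card (insert (x a) W) + card I + (\<Sum>i\<in>I. l i * r) \<le> M"
      using insert.prems(5) insert.hyps by simp
  qed
  then obtain B where B12: "\<forall>i\<in>I. star_at E (x i) (l i) (B i) \<and> \<Union>(B i) \<inter> insert (x a) W = {}"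
    and B3: "\<forall>i\<in>I. \<forall>j\<in>I. i \<noteq> j \<longrightarrow> \<Union>(B i) \<inter> \<Union>(B j) = {}"
    by (elim exE conjE) (rule that)
  have B: "\<And>i. i \<in> I \<Longrightarrow> star_at E (x i) (l i) (B i)"
      "\<And>i. i \<in> I \<Longrightarrow> \<Union>(B i) \<inter> insert (x a) W = {}"
      "\<And>i j. i \<in> I \<Longrightarrow> j \<in> I \<Longrightarrow> i \<noteq> j \<Longrightarrow> \<Union>(B i) \<inter> \<Union>(B j) = {}"
    using B12 B3 by simp_all
  define W' where "W' = W \<union> (\<Union>i\<in>I. \<Union>(B i))"
  obtain A where A: "star_at E (x a) M A" using insert.prems(2) by blast
  have size: "finite (\<Union>(B i))" "card (\<Union>(B i)) \<le> l i * r" if "i \<in> I" for i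
    using card_Union_star_le[OF assms(2) B(1)[OF that]] by auto
  have "finite W'" using insert.prems(3) insert.hyps(1) size by (auto simp: W'_def)
  moreover have "x a \<notin> W'" using B(2) insert.prems(4) by (auto simp: W'_def)
  moreover have "card W' + l a \<le> M"
  proof -
    have "card (\<Union>i\<in>I. \<Union>(B i)) \<le> (\<Sum>i\<in>I. card (\<Union>(B i)))"
      by (rule card_UN_le[OF insert.hyps(1)])
    also have "\<dots> \<le> (\<Sum>i\<in>I. l i * r)" by (rule sum_mono) (rule size)
    finally have "card W' \<le> card W + (\<Sum>i\<in>I. l i * r)"
      unfolding W'_def using card_Un_le[of W "\<Union>i\<in>I. \<Union>(B i)"] by linarith
    moreover have "l a \<le> l a * r"
    proof -
      \<comment> \<open>Positivity of \<open>r\<close> is read off an edge containing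
        \<open>x a\<close>; one exists because the budget for the nonempty index set forces
        \<open>M > 0\<close>.\<close>
      have "M \<noteq> 0" using insert.prems(5) insert.hyps by auto
      then obtain e where "e \<in> A" using A by (fastforce simp: star_at_def)
      then have "finite e" "card e = r" "x a \<in> e"
        using A assms(2) by (auto simp: star_at_def)
      then have "r > 0" by (auto simp: card_gt_0_iff)
      then show ?thesis by simp
    qed
    moreover have "card W + (l a * r + (\<Sum>i\<in>I. l i * r)) \<le> M"
      using insert.prems(5) insert.hyps by simp
    ultimately show ?thesis by linarith
  qed
  ultimately obtain C where C: "star_at E (x a) (l a) C" "\<Union>C \<inter> W' = {}"
    using star_avoiding[OF A] by blast
  let ?B = "B(a := C)"
  have CB: "\<Union>C \<inter> \<Union>(B i) = {}" "\<Union>C \<inter> W = {}" if "i \<in> I" for i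
    using C(2) that by (auto simp: W'_def)
  show ?case
  proof (intro exI[of _ ?B] conjI ballI impI)
    fix i assume "i \<in> insert a I"
    then show "star_at E (x i) (l i) (?B i)" using B(1) C(1) by auto
    show "\<Union>(?B i) \<inter> W = {}"
    proof (cases "i = a")
      case True
      then show ?thesis using C(2) by (auto simp: W'_def)
    next
      case False
      then show ?thesis using B(2)[of i] \<open>i \<in> insert a I\<close> by auto
    qed
  next
    fix i j assume ij: "i \<in> insert a I" "j \<in> insert a I" "i \<noteq> j"
    consider "i = a" "j \<in> I" "j \<noteq> a" | "j = a" "i \<in> I" "i \<noteq> a" | "i \<in> I" "j \<in> I" "i \<noteq> a" "j \<noteq> a"
      using ij by blast
    then show "\<Union>(?B i) \<inter> \<Union>(?B j) = {}"
    proof cases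
      case 1
      then show ?thesis using CB(1)[of j] by simp
    next
      case 2
      then show ?thesis using CB(1)[of i] by (simp add: Int_commute)
    next
      case 3
      then show ?thesis using B(3)[of i j] ij(3) by simp
    qed
  qed
qed

section \<open>Binomial estimates\<close>

text \<open>Pascal's rule applied \<open>j\<close> times; each application loses a term of at most
  \<open>n ^ (p - 1)\<close>.\<close>

lemma binomial_le_shifted:
  assumes "p \<ge> 1"
  shows "(n choose p) \<le> ((n - j) choose p) + j * n ^ (p - 1)"
proof (induction j)
  case (Suc j)
  have "((n - j) choose p) \<le> ((n - Suc j) choose p) + n ^ (p - 1)"
  proof (cases "n - j")
    case (Suc m)
    have "m choose (p - 1) \<le> m ^ (p - 1)" by (rule binomial_le_power)
    also have "\<dots> \<le> n ^ (p - 1)" using Suc by (intro power_mono) auto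
    finally have "m choose (p - 1) \<le> n ^ (p - 1)" .
    moreover have "Suc m choose p = (m choose (p - 1)) + (m choose p)"
      using assms by (cases p) auto
    moreover have "n - Suc j = m" using Suc by simp
    ultimately show ?thesis using Suc by simp
  qed simp
  then show ?case using Suc by (simp add: algebra_simps)
qed simp

text \<open>In the constant, \<open>p ^ p\<close> comes from the estimate of a binomial coefficient
  by the power of a quotient, and \<open>2 ^ p\<close> from
  \<open>n \<le> 2 * (n - j)\<close>.\<close>

lemma power_le_binomial:
  assumes "p \<ge> 1" "2 * j + 2 * p \<le> n"
  shows "n ^ p \<le> (2 * p) ^ p * ((n - j) choose p)"
proof -
  have "(real (n - j) / real p) ^ p \<le> real ((n - j) choose p)"
    using binomial_ge_n_over_k_pow_k[of p "n - j", where 'a = real] assms by simp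
  then have "real (n - j) ^ p \<le> real p ^ p * real ((n - j) choose p)"
    using assms by (simp add: power_divide field_simps)
  then have b: "(n - j) ^ p \<le> p ^ p * ((n - j) choose p)"
    by (metis of_nat_le_iff of_nat_mult of_nat_power)
  have "n ^ p \<le> (2 * (n - j)) ^ p" using assms by (intro power_mono) auto
  also have "\<dots> = 2 ^ p * (n - j) ^ p" by (rule power_mult_distrib)
  also have "\<dots> \<le> 2 ^ p * (p ^ p * ((n - j) choose p))" using b by (rule mult_le_mono2)
  also have "\<dots> = (2 * p) ^ p * ((n - j) choose p)" by (simp add: power_mult_distrib)
  finally show ?thesis .
qed

lemma eventually_power_le_binomial:
  fixes D :: nat
  assumes "p \<ge> 1"
  shows "\<forall>\<^sub>F n in sequentially. D * n ^ (p - 1) \<le> ((n - j) choose p)"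
  using eventually_ge_at_top[of "2 * j + 2 * p"] eventually_ge_at_top[of "D * (2 * p) ^ p"]
proof eventually_elim
  case (elim n)
  have "(2 * p) ^ p * (D * n ^ (p - 1)) = (D * (2 * p) ^ p) * n ^ (p - 1)" by (simp add: ac_simps)
  also have "\<dots> \<le> n * n ^ (p - 1)" using elim by (intro mult_le_mono1)
  also have "\<dots> = n ^ p" using assms by (metis power_eq_if not_one_le_zero)
  also have "\<dots> \<le> (2 * p) ^ p * ((n - j) choose p)"
    using power_le_binomial[OF assms] elim by blast
  finally show ?case using assms by (simp add: mult_le_cancel1)
qed

text \<open>This compares a host with too few rich vertices, whose leading coefficient is at most
  \<open>c - 1\<close>, with the extremal value, whose leading coefficient is \<open>c\<close>. Both
  the shift by \<open>j\<close> and the error term have order \<open>n ^ (p - 1)\<close> and are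
  absorbed by the one spare binomial coefficient.\<close>

lemma eventually_binomial_dominates:
  fixes c D :: nat
  assumes "p \<ge> 1" "c \<ge> 1"
  shows "\<forall>\<^sub>F n in sequentially. (c - 1) * (n choose p) + D * n ^ (p - 1) \<le> c * ((n - j) choose p)"
  using eventually_power_le_binomial[OF assms(1), of "(c - 1) * j + D" j]
proof eventually_elim
  case (elim n)
  have "(c - 1) * (n choose p) + D * n ^ (p - 1)
      \<le> (c - 1) * (((n - j) choose p) + j * n ^ (p - 1)) + D * n ^ (p - 1)"
    by (intro add_right_mono mult_le_mono2 binomial_le_shifted assms)
  also have "\<dots> = (c - 1) * ((n - j) choose p) + ((c - 1) * j + D) * n ^ (p - 1)"
    by (simp add: algebra_simps)
  also have "\<dots> \<le> (c - 1) * ((n - j) choose p) + ((n - j) choose p)"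
    using elim by (rule add_left_mono)
  also have "\<dots> = c * ((n - j) choose p)"
    using assms(2) by (cases c) auto
  finally show ?case .
qed

lemma binomial_less_mono:
  assumes "a < b" "1 \<le> q" "q \<le> b"
  shows "(a choose q) < (b choose q)"
proof -
  obtain b' q' where b: "b = Suc b'" and q: "q = Suc q'"
    using assms by (metis Suc_le_D One_nat_def less_imp_Suc_add)
  have "(a choose q) \<le> (b' choose q)" using assms b by (intro binomial_right_mono) simp
  moreover have "(b' choose q') > 0" using assms b q by simp
  moreover have "(b choose q) = (b' choose q') + (b' choose q)" by (simp add: b q)
  ultimately show ?thesis by linarith
qed

section \<open>The extremal problem\<close>

text \<open>If \<open>c\<close> lies in \<open>B\<close>, each edge adds at least one private vertex
  of \<open>B\<close>, giving \<open>q + 1\<close> in all. If not, each edge has two private ones,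
  and \<open>2 * q \<ge> q + 1\<close>.\<close>

lemma star_meets_set:
  assumes "star_at E c q A" "q \<ge> 1" "finite B" "\<And>e. e \<in> A \<Longrightarrow> card (e \<inter> B) \<ge> 2"
  shows "card (\<Union>A \<inter> B) \<ge> q + 1"
proof -
  let ?P = "\<Union>e\<in>A. e \<inter> B - {c}"
  have A: "finite A" "card A = q" "\<And>e. e \<in> A \<Longrightarrow> c \<in> e"
    "\<And>e e'. e \<in> A \<Longrightarrow> e' \<in> A \<Longrightarrow> e \<noteq> e' \<Longrightarrow> e \<inter> e' = {c}"
    using assms(1) by (auto simp: star_at_def)
  have P: "card ?P = (\<Sum>e\<in>A. card (e \<inter> B - {c}))"
  proof (rule card_UN_disjoint)
    show "\<forall>e\<in>A. \<forall>e'\<in>A. e \<noteq> e' \<longrightarrow> (e \<inter> B - {c}) \<inter> (e' \<inter> B - {c}) = {}"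
      using A(4) by blast
  qed (use A assms(3) in auto)
  show ?thesis
  proof (cases "c \<in> B")
    case True
    have "1 \<le> card (e \<inter> B - {c})" if "e \<in> A" for e
    proof -
      have "card (e \<inter> B - {c}) = card (e \<inter> B) - 1"
        using that True A(3) by (intro card_Diff_singleton) auto
      then show ?thesis using assms(4)[OF that] by simp
    qed
    then have "(\<Sum>e\<in>A. 1) \<le> card ?P" unfolding P by (rule sum_mono)
    then have "q \<le> card ?P" using A(2) by simp
    moreover have "\<Union>A \<inter> B = insert c ?P"
      using True A(2,3) assms(2) by (cases "A = {}") auto
    moreover have "card (insert c ?P) = card ?P + 1"
      using A(1) assms(3) by (subst card_insert_disjoint) auto
    ultimately show ?thesis by (simp only:)
  next
    case False
    then have "e \<inter> B - {c} = e \<inter> B" for e by blast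
    then have "(\<Sum>e\<in>A. 2) \<le> card ?P" unfolding P using assms(4) by (intro sum_mono) simp
    moreover have "card ?P \<le> card (\<Union>A \<inter> B)" using assms(3) by (intro card_mono) auto
    ultimately show ?thesis using A(2) assms(2) by simp
  qed
qed

lemma num_copies_le_ex_count: "G \<in> free_family r n F \<Longrightarrow> num_copies H G \<le> ex_count r n H F"
  unfolding ex_count_def by (intro Max_ge finite_num_copies_image imageI)

lemma ex_count_le:
  assumes "hedges F \<noteq> {}" "\<And>G. G \<in> free_family r n F \<Longrightarrow> num_copies H G \<le> b"
  shows "ex_count r n H F \<le> b"
  unfolding ex_count_def using free_family_nonempty[OF assms(1)] assms(2)
  by (intro Max.boundedI finite_num_copies_image) auto

lemma sum_split_at:
  fixes f :: "nat \<Rightarrow> nat"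
  assumes "1 \<le> r" "r \<le> s"
  shows "(\<Sum>i=0..s. f i) = (\<Sum>i=0..r - 1. f i) + (\<Sum>i=r..s. f i)"
proof -
  have "{0..s} = {0..r - 1} \<union> {r..s}" using assms by auto
  then show ?thesis using assms by (simp add: sum.union_disjoint)
qed

lemma cliques_restrict_edges:
  "cliques r i (V - A) {e \<in> E. e \<inter> A = {}} = cliques r i (V - A) E"
  unfolding cliques_def by blast

locale star_forest =
  fixes r k :: nat and l :: "nat \<Rightarrow> nat"
  assumes r: "r \<ge> 3" and k: "k \<ge> 1"
    and l_antimono: "\<And>i j. 1 \<le> i \<Longrightarrow> i \<le> j \<Longrightarrow> j \<le> k \<Longrightarrow> l j \<le> l i"
    and l_ge_2: "\<And>i. 1 \<le> i \<Longrightarrow> i \<le> k \<Longrightarrow> l i \<ge> 2"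
begin

section \<open>Hosts avoiding the forest and their rich vertices\<close>

abbreviation forest :: "(nat \<times> (nat + nat set \<times> nat)) hypergraph" where
  "forest \<equiv> star_expansion_union r k l"

lemma hedges_forest_nonempty: "hedges forest \<noteq> {}"
  using k l_ge_2[of k]
  by (auto simp: star_expansion_union_def disjoint_union_def hedges_expansion_star intro!: bexI[of _ k])

lemma copies_forest_nonempty_iff:
  assumes "r_graph r G"
  shows "copies forest G \<noteq> {} \<longleftrightarrow>
    (\<exists>c A. (\<forall>i\<in>{1..k}. star_at (hedges G) (c i) (l i) (A i)) \<and>
       (\<forall>i\<in>{1..k}. \<forall>j\<in>{1..k}. i \<noteq> j \<longrightarrow> \<Union>(A i) \<inter> \<Union>(A j) = {}))"
proof (rule copies_star_union_nonempty_iff)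
  show "l i \<ge> 1" if "i \<in> {1..k}" for i using l_ge_2[of i] that by simp
qed (use r assms in auto)

text \<open>The budget of \<open>disjoint_stars\<close> for \<open>k\<close> centres with nothing
  forbidden. It also suffices for \<open>k - 1\<close> centres when the at most
  \<open>l k * r\<close> vertices of one further star are forbidden.\<close>

definition threshold :: nat where "threshold = k + (\<Sum>i\<in>{1..k}. l i * r)"

definition rich :: "'a hypergraph \<Rightarrow> 'a set" where
  "rich G = {v \<in> verts G. \<exists>S. star_at (hedges G) v threshold S}"

lemma finite_rich: "r_graph r G \<Longrightarrow> finite (rich G)"
  by (simp add: rich_def r_graph_def)

lemma edges_finite: "r_graph r G \<Longrightarrow> \<forall>e\<in>hedges G. finite e \<and> card e = r"
  by (auto simp: r_graph_def intro: finite_subset)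

lemma card_rich_le:
  assumes G: "r_graph r G" and free: "copies forest G = {}"
  shows "card (rich G) \<le> k - 1"
proof (rule ccontr)
  assume "\<not> card (rich G) \<le> k - 1"
  then have "k \<le> card (rich G)" by simp
  then obtain X where X: "X \<subseteq> rich G" "card X = k" "finite X" by (rule obtain_subset_with_card_n)
  then obtain x where x: "bij_betw x {1..k} X" using ex_bij_betw_nat_finite_1 by blast
  have "\<exists>B. (\<forall>i\<in>{1..k}. star_at (hedges G) (x i) (l i) (B i) \<and> \<Union>(B i) \<inter> {} = {}) \<and>
    (\<forall>i\<in>{1..k}. \<forall>j\<in>{1..k}. i \<noteq> j \<longrightarrow> \<Union>(B i) \<inter> \<Union>(B j) = {})"
  proof (rule disjoint_stars)
    show "inj_on x {1..k}" using x by (simp add: bij_betw_def)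
    show "\<exists>A. star_at (hedges G) (x i) threshold A" if "i \<in> {1..k}" for i
      using X(1) bij_betwE[OF x] that unfolding rich_def by blast
    show "card {} + card {1..k} + (\<Sum>i\<in>{1..k}. l i * r) \<le> threshold" by (simp add: threshold_def)
  qed (use edges_finite[OF G] in auto)
  then have "copies forest G \<noteq> {}"
    unfolding copies_forest_nonempty_iff[OF G] by blast
  then show False using free by blast
qed

text \<open>Such a star would serve as the \<open>k\<close>-th component: the \<open>k - 1\<close>
  rich vertices lie outside it and can be made centres of the remaining stars, grown disjointly from
  it and from each other.\<close>

lemma no_star_off_rich:
  assumes G: "r_graph r G" and free: "copies forest G = {}" and card: "card (rich G) = k - 1"
  shows "\<not> star_at {e \<in> hedges G. e \<inter> rich G = {}} c (l k) S"
proof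
  assume star': "star_at {e \<in> hedges G. e \<inter> rich G = {}} c (l k) S"
  then have star: "star_at (hedges G) c (l k) S" and off: "\<Union>S \<inter> rich G = {}"
    by (auto simp: star_at_def)
  obtain x where x: "bij_betw x {1..k - 1} (rich G)"
    using ex_bij_betw_nat_finite_1[OF finite_rich[OF G]] card by metis
  have "{1..k} = insert k {1..k - 1}" using k by auto
  then have split: "(\<Sum>i\<in>{1..k}. l i * r) = l k * r + (\<Sum>i\<in>{1..k - 1}. l i * r)"
    using k by simp
  have "\<exists>B. (\<forall>i\<in>{1..k - 1}. star_at (hedges G) (x i) (l i) (B i) \<and> \<Union>(B i) \<inter> \<Union>S = {}) \<and>
    (\<forall>i\<in>{1..k - 1}. \<forall>j\<in>{1..k - 1}. i \<noteq> j \<longrightarrow> \<Union>(B i) \<inter> \<Union>(B j) = {})"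
  proof (rule disjoint_stars)
    show "inj_on x {1..k - 1}" using x by (simp add: bij_betw_def)
    show "\<exists>A. star_at (hedges G) (x i) threshold A" if "i \<in> {1..k - 1}" for i
      using bij_betwE[OF x] that unfolding rich_def by blast
    show "finite (\<Union>S)" using card_Union_star_le[OF edges_finite[OF G] star] by blast
    show "x ` {1..k - 1} \<inter> \<Union>S = {}" using x off by (auto simp: bij_betw_def)
    show "card (\<Union>S) + card {1..k - 1} + (\<Sum>i\<in>{1..k - 1}. l i * r) \<le> threshold"
      using card_Union_star_le(2)[OF edges_finite[OF G] star] unfolding threshold_def split card_atLeastAtMost
      by linarith
  qed (use edges_finite[OF G] in auto)
  then obtain B where B: "\<forall>i\<in>{1..k - 1}. star_at (hedges G) (x i) (l i) (B i) \<and> \<Union>(B i) \<inter> \<Union>S = {}"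
    and BB: "\<forall>i\<in>{1..k - 1}. \<forall>j\<in>{1..k - 1}. i \<noteq> j \<longrightarrow> \<Union>(B i) \<inter> \<Union>(B j) = {}"
    by (elim exE conjE) (rule that)
  let ?c = "x(k := c)" and ?B = "B(k := S)"
  have cases: "i = k \<or> i \<in> {1..k - 1} \<and> i \<noteq> k" if "i \<in> {1..k}" for i
    using that by auto
  have "star_at (hedges G) (?c i) (l i) (?B i)" if "i \<in> {1..k}" for i
    using cases[OF that] B star by auto
  moreover have "\<Union>(?B i) \<inter> \<Union>(?B j) = {}" if "i \<in> {1..k}" "j \<in> {1..k}" "i \<noteq> j" for i j
  proof -
    note ij = cases[OF that(1)] cases[OF that(2)] that(3)
    consider "i = k" "j \<noteq> k" "j \<in> {1..k - 1}" | "j = k" "i \<noteq> k" "i \<in> {1..k - 1}"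
      | "i \<noteq> k" "j \<noteq> k" "i \<in> {1..k - 1}" "j \<in> {1..k - 1}"
      using ij by blast
    then show ?thesis
    proof cases
      case 1
      then have "\<Union>(B j) \<inter> \<Union>S = {}" using B by blast
      then show ?thesis using 1 by (simp add: Int_commute)
    next
      case 2
      then have "\<Union>(B i) \<inter> \<Union>S = {}" using B by blast
      then show ?thesis using 2 by simp
    next
      case 3
      then have "\<Union>(B i) \<inter> \<Union>(B j) = {}" using BB ij(3) by blast
      then show ?thesis using 3 by simp
    qed
  qed
  ultimately have "copies forest G \<noteq> {}"
    unfolding copies_forest_nonempty_iff[OF G]
    by (intro exI[of _ ?c] exI[of _ ?B] conjI ballI impI)
  then show False using free by blast
qed

text \<open>The factor from \<open>card_cliques_le\<close> with \<open>t = threshold * r\<close>,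
  the cover size supplied by \<open>link_cover\<close>; it does not depend on the host.\<close>

definition clique_bound :: nat where "clique_bound = 2 ^ ((threshold * r + 1) ^ 3 * (r - 2))"

text \<open>Sizes below \<open>r - 1\<close> are bounded by counting all sets, sizes from
  \<open>r\<close> on by the spanning argument. At size \<open>r - 1\<close> every set counts, which
  gives order \<open>n ^ (r - 1)\<close> in general; hence the exclusion.\<close>

lemma card_cliques_off_rich_le:
  assumes G: "r_graph r G" and "verts G \<noteq> {}" and i: "i \<noteq> r - 1"
  shows "card (cliques r i (verts G - rich G) (hedges G)) \<le> clique_bound * card (verts G) ^ (r - 2)"
proof -
  have fin: "finite (verts G)" using G by (simp add: r_graph_def)
  have le: "card (verts G - rich G) \<le> card (verts G)" using fin by (intro card_mono) auto
  show ?thesis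
  proof (cases "i < r")
    case True
    have "card (cliques r i (verts G - rich G) (hedges G)) \<le> card (verts G - rich G) ^ i"
      using True fin by (simp add: card_cliques_less binomial_le_power)
    also have "\<dots> \<le> card (verts G) ^ i" using le by (rule power_mono) simp
    also have "\<dots> \<le> card (verts G) ^ (r - 2)"
      using True i fin assms(2) by (intro power_increasing) (auto simp: Suc_le_eq card_gt_0_iff)
    also have "\<dots> \<le> clique_bound * card (verts G) ^ (r - 2)" by (simp add: clique_bound_def)
    finally show ?thesis .
  next
    case False
    \<comment> \<open>Vertices outside \<open>verts G - rich G\<close> receive the empty set, so
      that the size bound holds everywhere, as \<open>card_cliques_le\<close> demands.\<close>
    have "\<forall>v. \<exists>T. finite T \<and> card T \<le> threshold * r \<and>
      (v \<in> verts G - rich G \<longrightarrow> v \<notin> T \<and> (\<forall>e\<in>hedges G. v \<in> e \<longrightarrow> e \<inter> T \<noteq> {}))"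
    proof
      fix v
      show "\<exists>T. finite T \<and> card T \<le> threshold * r \<and>
        (v \<in> verts G - rich G \<longrightarrow> v \<notin> T \<and> (\<forall>e\<in>hedges G. v \<in> e \<longrightarrow> e \<inter> T \<noteq> {}))"
      proof (cases "v \<in> verts G - rich G")
        case True
        then have "\<nexists>A. star_at (hedges G) v threshold A" unfolding rich_def by blast
        moreover have "finite (hedges G)"
          using G fin by (auto simp: r_graph_def intro: finite_subset[of _ "Pow (verts G)"])
        ultimately have "\<exists>T. finite T \<and> card T \<le> threshold * r \<and> v \<notin> T \<and> (\<forall>e\<in>hedges G. v \<in> e \<longrightarrow> e \<inter> T \<noteq> {})"
          using link_cover[OF _ edges_finite[OF G]] r by simp
        then show ?thesis by blast
      qed (auto intro: exI[of _ "{}"])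
    qed
    then obtain T where T: "\<forall>v. finite (T v) \<and> card (T v) \<le> threshold * r \<and>
      (v \<in> verts G - rich G \<longrightarrow> v \<notin> T v \<and> (\<forall>e\<in>hedges G. v \<in> e \<longrightarrow> e \<inter> T v \<noteq> {}))"
      by (rule choice[THEN exE])
    have "card (cliques r i (verts G - rich G) (hedges G)) \<le> clique_bound * card (verts G - rich G) ^ (r - 2)"
      unfolding clique_bound_def
    proof (rule card_cliques_le)
      show "finite (T v) \<and> card (T v) \<le> threshold * r" for v using T by blast
      show "v \<notin> T v" if "v \<in> verts G - rich G" for v using T that by blast
      show "e \<inter> T v \<noteq> {}" if "v \<in> verts G - rich G" "e \<in> hedges G" "v \<in> e" for v e
        using T that by blast
    qed (use fin r False in auto)
    also have "\<dots> \<le> clique_bound * card (verts G) ^ (r - 2)" using le by (intro mult_le_mono2 power_mono) auto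
    finally show ?thesis .
  qed
qed

text \<open>For \<open>r \<le> s\<close> and \<open>n \<ge> k\<close> this counts the
  \<open>s\<close>-cliques in the join of \<open>k - 1\<close> vertices with an optimal star-free
  \<open>r\<close>-graph; \<open>i\<close> is the number of clique vertices outside the
  \<open>k - 1\<close> ones.\<close>

definition extremal :: "nat \<Rightarrow> nat \<Rightarrow> nat" where
  "extremal s n = (\<Sum>i=0..r - 1. ((k - 1) choose (s - i)) * ((n - k + 1) choose i))
     + Max ((\<lambda>G. \<Sum>i=r..s. ((k - 1) choose (s - i)) * num_copies (complete_rgraph r i) G)
            ` free_family r (n - k + 1) (expansion r (star (l k))))"

lemma clique_sum_eq:
  assumes "r \<le> s" "r_graph r G" "card (verts G) = n - k + 1"
  shows "(\<Sum>i=0..s. ((k - 1) choose (s - i)) * card (cliques r i (verts G) (hedges G)))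
    = (\<Sum>i=0..r - 1. ((k - 1) choose (s - i)) * ((n - k + 1) choose i))
     + (\<Sum>i=r..s. ((k - 1) choose (s - i)) * num_copies (complete_rgraph r i) G)"
proof -
  have "(\<Sum>i=0..r - 1. ((k - 1) choose (s - i)) * card (cliques r i (verts G) (hedges G)))
      = (\<Sum>i=0..r - 1. ((k - 1) choose (s - i)) * ((n - k + 1) choose i))"
  proof (rule sum.cong)
    fix i assume "i \<in> {0..r - 1}"
    then have "i < r" using r by auto
    then show "((k - 1) choose (s - i)) * card (cliques r i (verts G) (hedges G))
        = ((k - 1) choose (s - i)) * ((n - k + 1) choose i)"
      using card_cliques_less[of "verts G" i r "hedges G"] assms(2,3) by (simp add: r_graph_def)
  qed simp
  then show ?thesis
    using sum_split_at[of r s] r assms(1) by (simp add: num_copies_complete_rgraph[OF assms(2)])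
qed

section \<open>Upper bounds\<close>

lemma free_familyD:
  assumes "G \<in> free_family r n forest"
  shows "r_graph r G" "finite (verts G)" "card (verts G) = n" "copies forest G = {}"
  using assms by (auto simp: free_family_def r_graph_def)

lemma num_copies_complete_le:
  assumes G: "G \<in> free_family r n forest"
  shows "num_copies (complete_rgraph r s) G
    \<le> (\<Sum>i=0..s. (card (rich G) choose (s - i)) * card (cliques r i (verts G - rich G) (hedges G)))"
  unfolding num_copies_complete_rgraph[OF free_familyD(1)[OF G]]
  by (rule card_cliques_split_le) (use free_familyD[OF G] in \<open>auto simp: rich_def\<close>)

lemma summand_le:
  assumes G: "G \<in> free_family r n forest" and "n \<ge> 1" "i \<noteq> r - 1"
  shows "(card (rich G) choose (s - i)) * card (cliques r i (verts G - rich G) (hedges G))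
    \<le> 2 ^ k * clique_bound * n ^ (r - 2)"
proof -
  have "(card (rich G) choose (s - i)) \<le> 2 ^ card (rich G)" by (rule binomial_le_pow2)
  also have "\<dots> \<le> 2 ^ k"
    using card_rich_le[of G] free_familyD[OF G] by (intro power_increasing) auto
  finally have "(card (rich G) choose (s - i)) \<le> 2 ^ k" .
  moreover have "card (cliques r i (verts G - rich G) (hedges G)) \<le> clique_bound * n ^ (r - 2)"
    using card_cliques_off_rich_le[of G i] free_familyD[OF G] assms(2,3) by force
  ultimately show ?thesis
    unfolding mult.assoc by (rule mult_le_mono)
qed

text \<open>Only the summand \<open>i = r - 1\<close> could exceed order \<open>n ^ (r - 2)\<close>.
  It needs \<open>s - (r - 1) \<ge> k\<close> rich vertices in one clique, but there are at most
  \<open>k - 1\<close>, so its binomial coefficient vanishes.\<close>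

lemma ex_count_le_power:
  assumes "k + r - 1 \<le> s" "n \<ge> 1"
  shows "ex_count r n (complete_rgraph r s) forest \<le> (s + 1) * (2 ^ k * clique_bound) * n ^ (r - 2)"
proof (rule ex_count_le[OF hedges_forest_nonempty])
  fix G assume G: "G \<in> free_family r n forest"
  have "(card (rich G) choose (s - i)) * card (cliques r i (verts G - rich G) (hedges G))
      \<le> 2 ^ k * clique_bound * n ^ (r - 2)" for i
  proof (cases "i = r - 1")
    case True
    have "card (rich G) \<le> k - 1" using card_rich_le[of G] free_familyD[OF G] by blast
    then have "card (rich G) < s - i" using True assms r k by linarith
    then show ?thesis by (simp add: binomial_eq_0)
  next
    case False
    then show ?thesis by (rule summand_le[OF G assms(2)])
  qed
  then have "(\<Sum>i=0..s. (card (rich G) choose (s - i)) * card (cliques r i (verts G - rich G) (hedges G)))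
      \<le> (\<Sum>i=0..s. 2 ^ k * clique_bound * n ^ (r - 2))"
    by (rule sum_mono)
  then show "num_copies (complete_rgraph r s) G \<le> (s + 1) * (2 ^ k * clique_bound) * n ^ (r - 2)"
    using num_copies_complete_le[OF G, of s] by (simp add: algebra_simps)
qed

lemma num_copies_le_extremal:
  assumes "r \<le> s" "n \<ge> k" and G: "G \<in> free_family r n forest" and card: "card (rich G) = k - 1"
  shows "num_copies (complete_rgraph r s) G \<le> extremal s n"
proof -
  define G' where "G' = (verts G - rich G, {e \<in> hedges G. e \<inter> rich G = {}})"
  have G': "r_graph r G'"
    using free_familyD(1)[OF G] by (auto simp: G'_def r_graph_def)
  have "card (verts G') = n - (k - 1)"
    unfolding G'_def fst_conv card[symmetric] free_familyD(3)[OF G, symmetric]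
    by (rule card_Diff_subset) (use finite_rich free_familyD[OF G] in \<open>auto simp: rich_def\<close>)
  \<comment> \<open>With truncated subtraction \<open>n - (k - 1)\<close> and
    \<open>n - k + 1\<close> agree only for \<open>n \<ge> k\<close>; below that they are
    \<open>0\<close> and \<open>1\<close>.\<close>
  then have cG': "card (verts G') = n - k + 1" using assms(2) k by simp
  have "\<not> copies (expansion r (star (l k))) G' \<noteq> {}"
  proof (subst copies_star_nonempty_iff)
    show "1 \<le> l k" using l_ge_2[of k] k by simp
    show "\<not> (\<exists>c A. star_at (hedges G') c (l k) A)"
      using no_star_off_rich[of G] free_familyD[OF G] card by (simp add: G'_def)
  qed (use r G' in auto)
  then have "G' \<in> free_family r (n - k + 1) (expansion r (star (l k)))"
    using G' cG' by (simp add: free_family_def)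
  then have "(\<Sum>i=r..s. ((k - 1) choose (s - i)) * num_copies (complete_rgraph r i) G')
      \<le> Max ((\<lambda>G. \<Sum>i=r..s. ((k - 1) choose (s - i)) * num_copies (complete_rgraph r i) G)
            ` free_family r (n - k + 1) (expansion r (star (l k))))"
    by (intro Max_ge finite_weighted_num_copies_image imageI)
  moreover have "num_copies (complete_rgraph r s) G
      \<le> (\<Sum>i=0..s. ((k - 1) choose (s - i)) * card (cliques r i (verts G') (hedges G')))"
    using num_copies_complete_le[OF G, of s] by (simp add: card G'_def cliques_restrict_edges)
  ultimately show ?thesis
    unfolding clique_sum_eq[OF assms(1) G' cG'] extremal_def by linarith
qed

text \<open>With exactly \<open>k - 1\<close> rich vertices the bound holds for every
  \<open>n \<ge> k\<close>. With fewer, the coefficient of \<open>n choose (r - 1)\<close> drops by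
  at least one, and large \<open>n\<close> makes this loss outweigh all other terms.\<close>

lemma eventually_ex_count_le_extremal:
  assumes "r \<le> s" "s \<le> k + r - 2"
  shows "\<forall>\<^sub>F n in sequentially. ex_count r n (complete_rgraph r s) forest \<le> extremal s n"
proof -
  \<comment> \<open>\<open>q\<close> is the number of rich vertices in a clique with exactly
    \<open>r - 1\<close> others. The bounds on \<open>s\<close> give
    \<open>1 \<le> q \<le> k - 1\<close>, which makes \<open>c\<close> positive and strictly larger
    than the coefficient for fewer rich vertices.\<close>
  define q where "q = s - (r - 1)"
  define c where "c = (k - 1) choose q"
  define D where "D = (s + 1) * (2 ^ k * clique_bound)"
  have q: "1 \<le> q" "q \<le> k - 1" using assms r by (auto simp: q_def)
  have "c \<ge> 1" unfolding c_def using zero_less_binomial[OF q(2)] by linarith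
  then have "\<forall>\<^sub>F n in sequentially. (c - 1) * (n choose (r - 1)) + D * n ^ (r - 1 - 1)
      \<le> c * ((n - (k - 1)) choose (r - 1))"
    using r by (intro eventually_binomial_dominates) auto
  then show ?thesis
    using eventually_ge_at_top[of k]
  proof eventually_elim
    case (elim n)
    show ?case
    proof (rule ex_count_le[OF hedges_forest_nonempty])
      fix G assume G: "G \<in> free_family r n forest"
      show "num_copies (complete_rgraph r s) G \<le> extremal s n"
      proof (cases "card (rich G) = k - 1")
        case True
        then show ?thesis using num_copies_le_extremal assms(1) elim(2) G by blast
      next
        case False
        then have less: "card (rich G) < k - 1"
          using card_rich_le[of G] free_familyD[OF G] by fastforce
        let ?f = "\<lambda>i. (card (rich G) choose (s - i)) * card (cliques r i (verts G - rich G) (hedges G))"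
        have "?f (r - 1) \<le> (c - 1) * (n choose (r - 1))"
        proof (rule mult_le_mono)
          have "(card (rich G) choose q) < c"
            unfolding c_def using less q by (rule binomial_less_mono)
          then show "(card (rich G) choose (s - (r - 1))) \<le> c - 1" by (simp add: q_def)
          have "card (cliques r (r - 1) (verts G - rich G) (hedges G)) = card (verts G - rich G) choose (r - 1)"
            using r free_familyD(2)[OF G] by (intro card_cliques_less) auto
          also have "\<dots> \<le> n choose (r - 1)"
            using free_familyD(2,3)[OF G] card_mono[of "verts G" "verts G - rich G"]
            by (intro binomial_right_mono) auto
          finally show "card (cliques r (r - 1) (verts G - rich G) (hedges G)) \<le> n choose (r - 1)" .
        qed
        \<comment> \<open>All summands other than the leading one have order
          \<open>n ^ (r - 2)\<close>; \<open>D\<close> allows for \<open>s + 1\<close> of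
          them.\<close>
        moreover have "(\<Sum>i\<in>{0..s} - {r - 1}. ?f i) \<le> D * n ^ (r - 1 - 1)"
        proof -
          have "(\<Sum>i\<in>{0..s} - {r - 1}. ?f i) \<le> (\<Sum>i\<in>{0..s} - {r - 1}. 2 ^ k * clique_bound * n ^ (r - 2))"
            using elim(2) k by (intro sum_mono summand_le[OF G]) auto
          also have "\<dots> \<le> (\<Sum>i\<in>{0..s}. 2 ^ k * clique_bound * n ^ (r - 2))"
            by (rule sum_mono2) auto
          also have "\<dots> = D * n ^ (r - 1 - 1)" by (simp add: D_def algebra_simps numeral_2_eq_2)
          finally show ?thesis .
        qed
        moreover have "(\<Sum>i\<in>{0..s}. ?f i) = ?f (r - 1) + (\<Sum>i\<in>{0..s} - {r - 1}. ?f i)"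
          using assms r by (intro sum.remove) auto
        ultimately have "num_copies (complete_rgraph r s) G \<le> c * ((n - (k - 1)) choose (r - 1))"
          using num_copies_complete_le[OF G, of s] elim(1) by linarith
        also have "\<dots> = ((k - 1) choose (s - (r - 1))) * ((n - k + 1) choose (r - 1))"
        proof -
          have "n - (k - 1) = n - k + 1" using elim(2) k by linarith
          then show ?thesis by (simp only: c_def q_def)
        qed
        \<comment> \<open>The single summand \<open>i = r - 1\<close> of the extremal value already
          suffices.\<close>
        also have "\<dots> \<le> (\<Sum>i=0..r - 1. ((k - 1) choose (s - i)) * ((n - k + 1) choose i))"
          by (rule member_le_sum) auto
        also have "\<dots> \<le> extremal s n" by (simp add: extremal_def)
        finally show ?thesis .
      qed
    qed
  qed
qed

section \<open>Lower bounds\<close>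

lemma extremal_le_ex_count:
  assumes "r \<le> s" "n \<ge> k"
  shows "extremal s n \<le> ex_count r n (complete_rgraph r s) forest"
proof -
  let ?F = "free_family r (n - k + 1) (expansion r (star (l k)))"
  let ?w = "\<lambda>G. \<Sum>i=r..s. ((k - 1) choose (s - i)) * num_copies (complete_rgraph r i) G"
  have lk: "1 \<le> l k" using l_ge_2[of k] k by simp
  have "?F \<noteq> {}"
    using lk by (intro free_family_nonempty) (simp add: hedges_expansion_star)
  then have "Max (?w ` ?F) \<in> ?w ` ?F"
    by (intro Max_in finite_weighted_num_copies_image) simp
  then obtain G' where G': "G' \<in> ?F" and max: "Max (?w ` ?F) = ?w G'" by blast
  have rG': "r_graph r G'" and cG': "card (verts G') = n - k + 1" and free': "copies (expansion r (star (l k))) G' = {}"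
    using G' by (auto simp: free_family_def)
  have fin': "finite (verts G')" using rG' by (simp add: r_graph_def)
  \<comment> \<open>Host vertices are naturals, so \<open>k - 1\<close> fresh ones are available for
    the join.\<close>
  have "infinite (- verts G')" using fin' by (simp add: infinite_UNIV_nat Compl_eq_Diff_UNIV)
  then obtain A where A: "A \<subseteq> - verts G'" "finite A" "card A = k - 1"
    using infinite_arbitrarily_large by blast
  define V where "V = verts G' \<union> A"
  define E where "E = hedges G' \<union> {e. e \<subseteq> V \<and> card e = r \<and> e \<inter> A \<noteq> {}}"
  have VA: "V - A = verts G'" using A(1) by (auto simp: V_def)
  have "card V = card (verts G') + card A"
    unfolding V_def using fin' A by (intro card_Un_disjoint) auto
  then have cV: "card V = n" using cG' A(3) assms(2) k by simp
  have rG: "r_graph r (V, E)"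
    using rG' A(2) by (auto simp: r_graph_def E_def V_def)
  have "\<not> copies forest (V, E) \<noteq> {}"
  proof
    assume "copies forest (V, E) \<noteq> {}"
    then obtain c S where S: "\<forall>i\<in>{1..k}. star_at E (c i) (l i) (S i)"
      and disj: "\<forall>i\<in>{1..k}. \<forall>j\<in>{1..k}. i \<noteq> j \<longrightarrow> \<Union>(S i) \<inter> \<Union>(S j) = {}"
      unfolding copies_forest_nonempty_iff[OF rG] snd_conv by (elim exE conjE) (rule that)
    \<comment> \<open>Pigeonhole: \<open>k\<close> disjoint stars cannot all meet a set of
      \<open>k - 1\<close> vertices. The one that misses \<open>A\<close> lies entirely in
      \<open>G'\<close>.\<close>
    have "\<exists>i\<in>{1..k}. \<Union>(S i) \<inter> A = {}"
    proof (rule ccontr)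
      assume "\<not> ?thesis"
      then have "\<forall>i\<in>{1..k}. \<exists>a. a \<in> \<Union>(S i) \<inter> A" by blast
      then obtain a where a: "\<forall>i\<in>{1..k}. a i \<in> \<Union>(S i) \<inter> A" by (rule bchoice[THEN exE])
      have "inj_on a {1..k}"
      proof (rule inj_onI, rule ccontr)
        fix i j assume ij: "i \<in> {1..k}" "j \<in> {1..k}" "a i = a j" "i \<noteq> j"
        then have "\<Union>(S i) \<inter> \<Union>(S j) = {}" using disj by blast
        moreover have "a i \<in> \<Union>(S i)" using a ij(1) by blast
        moreover have "a i \<in> \<Union>(S j)" using a ij(2) unfolding ij(3) by blast
        ultimately show False by blast
      qed
      moreover have "a ` {1..k} \<subseteq> A" using a by blast
      ultimately have "card {1..k} \<le> card A" using A(2) by (rule card_inj_on_le)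
      then show False using A(3) k by simp
    qed
    then obtain i where i: "i \<in> {1..k}" and off: "\<Union>(S i) \<inter> A = {}" by blast
    have Si: "star_at E (c i) (l i) (S i)" using S i by blast
    have "S i \<subseteq> hedges G'"
    proof
      fix e assume e: "e \<in> S i"
      then have "e \<in> E" using Si by (auto simp: star_at_def)
      moreover have "e \<inter> A = {}" using off e by blast
      ultimately show "e \<in> hedges G'" by (simp add: E_def)
    qed
    then have "star_at (hedges G') (c i) (l i) (S i)"
      using Si by (simp add: star_at_def)
    \<comment> \<open>\<open>l k\<close> is the smallest of the star sizes, so whichever star misses
      \<open>A\<close> can be trimmed to \<open>l k\<close> edges, contradicting the choice of
      \<open>G'\<close>.\<close>
    moreover have "l k \<le> card (S i)"
      using l_antimono[of i k] i Si by (simp add: star_at_def)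
    then obtain B where B: "B \<subseteq> S i" "card B = l k"
      by (rule obtain_subset_with_card_n)
    ultimately have "star_at (hedges G') (c i) (l k) B"
      using star_at_subset by metis
    then show False
      using copies_star_nonempty_iff[of r "l k" G'] r lk rG' free' by auto
  qed
  then have free: "(V, E) \<in> free_family r n forest"
    using rG cV by (simp add: free_family_def)
  \<comment> \<open>All added edges meet \<open>A\<close>, so cliques outside \<open>A\<close> are
    those of \<open>G'\<close>.\<close>
  have eq: "cliques r i (V - A) E = cliques r i (verts G') (hedges G')" for i
  proof -
    have "{e \<in> E. e \<inter> A = {}} = {e \<in> hedges G'. e \<inter> A = {}}" by (auto simp: E_def)
    then have "cliques r i (V - A) E = cliques r i (V - A) (hedges G')"
      using cliques_restrict_edges[of r i V A E] cliques_restrict_edges[of r i V A "hedges G'"] by simp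
    then show ?thesis by (simp add: VA)
  qed
  have "card (cliques r s V E) = (\<Sum>i=0..s. (card A choose (s - i)) * card (cliques r i (V - A) E))"
  proof (rule card_cliques_split_eq)
    show "finite V" using fin' A(2) by (simp add: V_def)
    show "A \<subseteq> V" by (simp add: V_def)
    show "e \<in> E" if "e \<subseteq> V" "card e = r" "e \<inter> A \<noteq> {}" for e
      using that by (simp add: E_def)
  qed
  also have "\<dots> = (\<Sum>i=0..s. ((k - 1) choose (s - i)) * card (cliques r i (verts G') (hedges G')))"
    by (simp only: eq A(3))
  also have "\<dots> = extremal s n"
    unfolding clique_sum_eq[OF assms(1) rG' cG'] extremal_def max ..
  finally have "extremal s n = num_copies (complete_rgraph r s) (V, E)"
    by (simp add: num_copies_complete_rgraph[OF rG])
  also have "\<dots> \<le> ex_count r n (complete_rgraph r s) forest"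
    by (rule num_copies_le_ex_count[OF free])
  finally show ?thesis .
qed

text \<open>If every edge meets \<open>B\<close> at least twice, the forest needs
  \<open>m + 1\<close> vertices of \<open>B\<close>, one more than there are. A fixed
  \<open>P \<subseteq> B\<close> with \<open>s - (r - 2)\<close> elements forms a clique with every
  \<open>(r - 2)\<close>-set outside \<open>B\<close>.\<close>

lemma binomial_le_ex_count:
  assumes "r \<le> s" "s \<le> (\<Sum>i=1..k. (l i + 1)) + r - 3"
  defines "m \<equiv> (\<Sum>i=1..k. (l i + 1)) - 1"
  assumes "m \<le> n"
  shows "((n - m) choose (r - 2)) \<le> ex_count r n (complete_rgraph r s) forest"
proof -
  define V :: "nat set" where "V = {..<n}"
  define B :: "nat set" where "B = {..<m}"
  define E where "E = {e. e \<subseteq> V \<and> card e = r \<and> card (e \<inter> B) \<ge> 2}"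
  \<comment> \<open>This makes the sum positive, so that the truncated subtraction in
    \<open>m\<close> really gives one less than the sum.\<close>
  have "l k + 1 \<le> (\<Sum>i=1..k. (l i + 1))"
    using k by (intro member_le_sum) auto
  then have sum_ge: "3 \<le> (\<Sum>i=1..k. (l i + 1))" using l_ge_2[of k] k by linarith
  have BV: "B \<subseteq> V" and fin: "finite V" "finite B" using assms(4) by (auto simp: B_def V_def)
  have rG: "r_graph r (V, E)" using fin by (auto simp: r_graph_def E_def)
  have "\<not> copies forest (V, E) \<noteq> {}"
  proof
    assume "copies forest (V, E) \<noteq> {}"
    then obtain c S where S: "\<forall>i\<in>{1..k}. star_at E (c i) (l i) (S i)"
      and disj: "\<forall>i\<in>{1..k}. \<forall>j\<in>{1..k}. i \<noteq> j \<longrightarrow> \<Union>(S i) \<inter> \<Union>(S j) = {}"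
      unfolding copies_forest_nonempty_iff[OF rG] snd_conv by (elim exE conjE) (rule that)
    have "l i + 1 \<le> card (\<Union>(S i) \<inter> B)" if i: "i \<in> {1..k}" for i
    proof (rule star_meets_set)
      show Si: "star_at E (c i) (l i) (S i)" using S i by blast
      show "1 \<le> l i" using l_ge_2[of i] i by simp
      show "2 \<le> card (e \<inter> B)" if "e \<in> S i" for e using that Si by (auto simp: star_at_def E_def)
    qed (rule fin)
    then have "(\<Sum>i=1..k. (l i + 1)) \<le> (\<Sum>i=1..k. card (\<Union>(S i) \<inter> B))" by (rule sum_mono)
    also have "\<dots> = card (\<Union>i\<in>{1..k}. \<Union>(S i) \<inter> B)"
    proof (rule card_UN_disjoint[symmetric])
      show "\<forall>i\<in>{1..k}. \<forall>j\<in>{1..k}. i \<noteq> j \<longrightarrow> (\<Union>(S i) \<inter> B) \<inter> (\<Union>(S j) \<inter> B) = {}"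
      proof (intro ballI impI)
        fix i j assume "i \<in> {1..k}" "j \<in> {1..k}" "i \<noteq> j"
        then have "\<Union>(S i) \<inter> \<Union>(S j) = {}" using disj by blast
        then show "(\<Union>(S i) \<inter> B) \<inter> (\<Union>(S j) \<inter> B) = {}" by blast
      qed
    qed (use fin in auto)
    also have "\<dots> \<le> card B" using fin by (intro card_mono) auto
    also have "\<dots> = m" by (simp add: B_def)
    finally show False using sum_ge unfolding m_def by linarith
  qed
  then have free: "(V, E) \<in> free_family r n forest"
    using rG by (simp add: free_family_def V_def)
  \<comment> \<open>Exactly the upper bound on \<open>s\<close>: it says that \<open>B\<close> has
    room for the clique vertices beyond the \<open>r - 2\<close> outside ones.\<close>
  have "s - (r - 2) \<le> card B" using assms(1,2) sum_ge r by (simp add: B_def m_def)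
  then obtain P where P: "P \<subseteq> B" "card P = s - (r - 2)" "finite P" by (rule obtain_subset_with_card_n)
  let ?R = "{R. R \<subseteq> V - B \<and> card R = r - 2}"
  have "(\<lambda>R. P \<union> R) ` ?R \<subseteq> cliques r s V E"
  proof (intro image_subsetI)
    fix R assume "R \<in> ?R"
    then have R: "R \<subseteq> V - B" "card R = r - 2" "finite R" using fin by (auto intro: finite_subset)
    have "card (P \<union> R) = card P + card R" using P R by (intro card_Un_disjoint) auto
    then have "card (P \<union> R) = s" using P R assms(1) r by simp
    \<comment> \<open>At most \<open>r - 2\<close> vertices of \<open>e\<close> lie in
      \<open>R\<close>, so at least two lie in \<open>B\<close>.\<close>
    moreover have "e \<in> E" if e: "e \<subseteq> P \<union> R" "card e = r" for e
    proof -
      have fe: "finite e" using e P R by (auto intro: finite_subset)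
      have "card (e - B) \<le> r - 2" using e P R card_mono[of R "e - B"] by auto
      moreover have "card e = card (e \<inter> B) + card (e - B)"
        using card_Un_disjoint[of "e \<inter> B" "e - B"] fe by (simp add: Int_Diff_Un Int_Diff_disjoint)
      ultimately have "2 \<le> card (e \<inter> B)" using e(2) r by linarith
      then show ?thesis using e P R BV by (auto simp: E_def)
    qed
    ultimately show "P \<union> R \<in> cliques r s V E"
      using P R BV by (auto simp: cliques_def)
  qed
  moreover have "inj_on (\<lambda>R. P \<union> R) ?R"
    by (rule inj_onI) (use P in blast)
  ultimately have "card ?R \<le> card (cliques r s V E)"
    using finite_cliques[OF fin(1)] by (metis card_inj_on_le)
  also have "\<dots> = num_copies (complete_rgraph r s) (V, E)"
    by (simp add: num_copies_complete_rgraph[OF rG])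
  also have "\<dots> \<le> ex_count r n (complete_rgraph r s) forest"
    by (rule num_copies_le_ex_count[OF free])
  finally have "card ?R \<le> ex_count r n (complete_rgraph r s) forest" .
  moreover have "card ?R = (n - m) choose (r - 2)"
  proof -
    have "card (V - B) = n - m" using BV fin by (subst card_Diff_subset) (auto simp: V_def B_def)
    then show ?thesis using n_subsets[of "V - B" "r - 2"] fin by simp
  qed
  ultimately show ?thesis by simp
qed

section \<open>Asymptotic form of the bounds\<close>

lemma ex_count_bigo:
  assumes "k + r - 1 \<le> s"
  shows "(\<lambda>n. real (ex_count r n (complete_rgraph r s) forest)) \<in> O(\<lambda>n. real n ^ (r - 2))"
proof (rule bigoI)
  show "\<forall>\<^sub>F n in sequentially. norm (real (ex_count r n (complete_rgraph r s) forest))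
      \<le> real ((s + 1) * (2 ^ k * clique_bound)) * norm (real n ^ (r - 2))"
    using eventually_ge_at_top[of 1]
  proof eventually_elim
    case (elim n)
    have "real (ex_count r n (complete_rgraph r s) forest) \<le> real ((s + 1) * (2 ^ k * clique_bound) * n ^ (r - 2))"
      using ex_count_le_power[OF assms elim] by (simp only: of_nat_le_iff)
    then show ?case by simp
  qed
qed

lemma power_bigo_ex_count:
  assumes "r \<le> s" "s \<le> (\<Sum>i=1..k. (l i + 1)) + r - 3"
  shows "(\<lambda>n. real n ^ (r - 2)) \<in> O(\<lambda>n. real (ex_count r n (complete_rgraph r s) forest))"
proof (rule bigoI)
  define m where "m = (\<Sum>i=1..k. (l i + 1)) - 1"
  let ?p = "r - 2"
  show "\<forall>\<^sub>F n in sequentially. norm (real n ^ ?p)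
      \<le> real ((2 * ?p) ^ ?p) * norm (real (ex_count r n (complete_rgraph r s) forest))"
    using eventually_ge_at_top[of "2 * m + 2 * ?p"]
  proof eventually_elim
    case (elim n)
    have "n ^ ?p \<le> (2 * ?p) ^ ?p * ((n - m) choose ?p)"
      using r elim by (intro power_le_binomial) auto
    also have "\<dots> \<le> (2 * ?p) ^ ?p * ex_count r n (complete_rgraph r s) forest"
      using binomial_le_ex_count[OF assms, of n] elim by (intro mult_le_mono2) (simp add: m_def)
    finally have "real (n ^ ?p) \<le> real ((2 * ?p) ^ ?p * ex_count r n (complete_rgraph r s) forest)"
      by (simp only: of_nat_le_iff)
    then show ?case by simp
  qed
qed

end

theorem theorem2p6:
  fixes r k s :: nat and l :: "nat \<Rightarrow> nat"
  assumes "r \<ge> 3" and "k \<ge> 1"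
    and "\<And>i j. 1 \<le> i \<Longrightarrow> i \<le> j \<Longrightarrow> j \<le> k \<Longrightarrow> l j \<le> l i"
    and "\<And>i. 1 \<le> i \<Longrightarrow> i \<le> k \<Longrightarrow> l i \<ge> 2"
    and "s \<ge> r"
  shows
    "(s \<le> k + r - 2 \<longrightarrow>
       (\<forall>\<^sub>F n in sequentially.
          ex_count r n (complete_rgraph r s) (star_expansion_union r k l) =
            (\<Sum>i=0..r - 1. ((k - 1) choose (s - i)) * ((n - k + 1) choose i))
            + Max ((\<lambda>G. \<Sum>i=r..s. ((k - 1) choose (s - i)) * num_copies (complete_rgraph r i) G)
                   ` free_family r (n - k + 1) (expansion r (star (l k))))))
     \<and> (k + r - 1 \<le> s \<longrightarrow>
         (\<lambda>n. real (ex_count r n (complete_rgraph r s) (star_expansion_union r k l))) \<in> O(\<lambda>n. real n ^ (r - 2))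
         \<and> (s \<le> (\<Sum>i=1..k. (l i + 1)) + r - 3 \<longrightarrow>
              (\<lambda>n. real (ex_count r n (complete_rgraph r s) (star_expansion_union r k l))) \<in> \<Theta>(\<lambda>n. real n ^ (r - 2))))"
proof -
  interpret star_forest r k l
    using assms(1-4) by unfold_locales
  show ?thesis
  proof (intro conjI impI)
    assume "s \<le> k + r - 2"
    from eventually_ex_count_le_extremal[OF assms(5) this] eventually_ge_at_top[of k]
    have "\<forall>\<^sub>F n in sequentially. ex_count r n (complete_rgraph r s) forest = extremal s n"
    proof eventually_elim
      case (elim n)
      show ?case using elim(1) extremal_le_ex_count[OF assms(5) elim(2)] by (rule antisym)
    qed
    then show "\<forall>\<^sub>F n in sequentially. ex_count r n (complete_rgraph r s) forest =
        (\<Sum>i=0..r - 1. ((k - 1) choose (s - i)) * ((n - k + 1) choose i))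
        + Max ((\<lambda>G. \<Sum>i=r..s. ((k - 1) choose (s - i)) * num_copies (complete_rgraph r i) G)
               ` free_family r (n - k + 1) (expansion r (star (l k))))"
      unfolding extremal_def .
  next
    assume "k + r - 1 \<le> s"
    then show "(\<lambda>n. real (ex_count r n (complete_rgraph r s) forest)) \<in> O(\<lambda>n. real n ^ (r - 2))"
      by (rule ex_count_bigo)
  next
    assume "k + r - 1 \<le> s" "s \<le> (\<Sum>i=1..k. (l i + 1)) + r - 3"
    then show "(\<lambda>n. real (ex_count r n (complete_rgraph r s) forest)) \<in> \<Theta>(\<lambda>n. real n ^ (r - 2))"
      by (intro bigthetaI ex_count_bigo power_bigo_ex_count[THEN bigomega_iff_bigo[THEN iffD2]] assms(5))
  qed
qed

end
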